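(* Let $1<p<\infty$ and $p\le q<\infty$. Then $RH_{L(p,q)}=RH_p$.
   Context: A weight is a positive locally integrable function on $\mathbb{R}^n$. All cubes $Q\subset\mathbb{R}^n$ have sides parallel to the coordinate axes. $f^*$ is the nonincreasing rearrangement of $f$ (with respect to Lebesgue measure) and $f^{**}(t)=\frac1t\int_0^tf^*(s)\,ds$. For $1<p<\infty$, $1\le q<\infty$, the Lorentz space is $L(p,q)=\{f:\|f\|_{L(p,q)}=\left(\int_0^\infty f^{**}(t)^qt^{q/p}\frac{dt}{t}\right)^{1/q}<\infty\}$. $RH_{L(p,q)}$ is the class of weights $w$ for which there is $C>0$ such that for all cubes $Q$, $\frac{\|w\chi_Q\|_{L(p,q)}}{|Q|^{1/p}}\le\frac{C}{|Q|}\int_Qw(x)\,dx$. $RH_p$ is the class of weights $w$ for which there is $C>0$ such that for all cubes $Q$, $\left(\frac1{|Q|}\int_Q w(x)^p\,dx\right)^{1/p}\le C\frac1{|Q|}\int_Q w(x)\,dx$. *)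

theory Defs
  imports "HOL-Analysis.Analysis"
begin

text \<open>
  Functions on \<open>\<real>\<^sup>n\<close> have type \<^typ>\<open>real ^ 'n \<Rightarrow> real\<close>, with \<open>n = CARD('n)\<close>. Quantities that may be
  infinite take values in \<^typ>\<open>ennreal\<close>.
\<close>

definition locally_integrable :: "(real ^ 'n \<Rightarrow> real) \<Rightarrow> bool" where
  "locally_integrable f \<longleftrightarrow> (\<forall>K. compact K \<longrightarrow> set_integrable lebesgue K f)"

text \<open>
  Locally integrable functions are identified when they agree almost everywhere, so positivity is
  required almost everywhere. Thus a power \<open>\<lambda>x. norm x powr a\<close>, \<open>a > -n\<close>, is a weight although it
  vanishes at the origin.
\<close>

definition weight :: "(real ^ 'n \<Rightarrow> real) \<Rightarrow> bool" where
  "weight w \<longleftrightarrow> locally_integrable w \<and> (AE x in lebesgue. 0 < w x)"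

definition cubes :: "(real ^ 'n) set set" where
  "cubes = {cbox a (\<chi> i. a $ i + l) | a l. 0 < l}"

text \<open>Power with a real exponent \<open>r > 0\<close>, extended by \<open>\<infinity> ^ r = \<infinity>\<close>.\<close>

definition ennpowr :: "ennreal \<Rightarrow> real \<Rightarrow> ennreal" where
  "ennpowr x r = (if x = \<infinity> then \<infinity> else ennreal (enn2real x powr r))"

definition rearrangement :: "(real ^ 'n \<Rightarrow> real) \<Rightarrow> real \<Rightarrow> ennreal" where
  "rearrangement f t =
     Inf {s :: ennreal. emeasure lebesgue {x. s < ennreal \<bar>f x\<bar>} \<le> ennreal t}"

definition rearrangement_avg :: "(real ^ 'n \<Rightarrow> real) \<Rightarrow> real \<Rightarrow> ennreal" where
  "rearrangement_avg f t =
     (\<integral>\<^sup>+ s \<in> {0<..<t}. rearrangement f s \<partial>lborel) / ennreal t"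

definition Lorentz_norm :: "real \<Rightarrow> real \<Rightarrow> (real ^ 'n \<Rightarrow> real) \<Rightarrow> ennreal" where
  "Lorentz_norm p q f =
     ennpowr (\<integral>\<^sup>+ t \<in> {0<..}.
       ennpowr (rearrangement_avg f t) q * ennreal (t powr (q / p)) / ennreal t \<partial>lborel) (1 / q)"

definition RH_Lorentz :: "real \<Rightarrow> real \<Rightarrow> (real ^ 'n \<Rightarrow> real) set" where
  "RH_Lorentz p q = {w. weight w \<and>
     (\<exists>C>0. \<forall>Q\<in>cubes.
        Lorentz_norm p q (\<lambda>x. w x * indicator Q x) / ennreal (measure lebesgue Q powr (1 / p))
          \<le> ennreal (C / measure lebesgue Q * (LINT x:Q|lebesgue. w x)))}"

definition RH :: "real \<Rightarrow> (real ^ 'n \<Rightarrow> real) set" where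
  "RH p = {w. weight w \<and>
     (\<exists>C>0. \<forall>Q\<in>cubes.
        ennpowr ((\<integral>\<^sup>+ x \<in> Q. ennreal (w x powr p) \<partial>lebesgue) / ennreal (measure lebesgue Q)) (1 / p)
          \<le> ennreal (C * (1 / measure lebesgue Q * (LINT x:Q|lebesgue. w x))))}"

end

theory Submission
  imports Defs
begin

text \<open>
  One inclusion is an embedding of function spaces. For \<open>p \<le> q\<close> the Lorentz norm of any measurable
  function is at most a constant times its \<open>L\<^sup>p\<close> norm (lemma \<open>Lorentz_norm_le\<close>), and applying this
  to \<open>w \<chi>\<^sub>Q\<close> turns the reverse Holder inequality for \<open>L\<^sup>p\<close> into the one for \<open>L(p,q)\<close>. The embedding
  combines the weak-type bound \<open>f\<^sup>*\<^sup>*(t)\<^sup>p \<le> C I / t\<close>, where \<open>I = \<integral>\<bar>f\<bar>\<^sup>p\<close>, with the Hardy inequality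
  \<open>\<integral> f\<^sup>*\<^sup>*(t)\<^sup>p dt \<le> C I\<close>. Both follow from \<open>t f\<^sup>*\<^sup>*(t) \<le> t s + \<integral>\<^bsub>{\<bar>f\<bar> > s}\<^esub> \<bar>f\<bar>\<close>, valid for every \<open>s \<ge> 0\<close>.

  The converse is not an embedding, since \<open>L(p,q)\<close> is larger than \<open>L\<^sup>p\<close> when \<open>q > p\<close>. It is a
  self-improvement in the spirit of Gehring, and it rests on \<open>q < \<infinity>\<close>: the power \<open>\<bar>x\<bar>\<^bsup>-n/p\<^esup>\<close> satisfies the
  reverse inequality for weak \<open>L\<^sup>p\<close> but is not locally in \<open>L\<^sup>p\<close>. Put \<open>r = q / p \<ge> 1\<close>. Fix a cube with
  average \<open>u\<close> of \<open>w\<close>, and let \<open>V\<^sub>\<sigma>\<close> be the union of its dyadic subcubes on which the average of \<open>w\<close> exceeds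
  \<open>\<sigma>\<close>. Three facts carry the argument.

  \<^item> If \<open>E\<^sub>k \<subseteq> Q\<close> and \<open>w\<close> has average at least \<open>2\<^sup>k s\<close> on each \<open>E\<^sub>k\<close>, then \<open>f\<^sup>*\<^sup>* \<ge> 2\<^sup>k s\<close> on
    \<open>(0, \<bar>E\<^sub>k\<bar>]\<close> for \<open>f = w \<chi>\<^sub>Q\<close>. Hence \<open>\<Sum>\<^sub>k (2\<^sup>k s)\<^sup>q \<bar>E\<^sub>k\<bar>\<^sup>r\<close> is at most a constant times the
    \<open>q\<close>-th power of the Lorentz norm of \<open>f\<close> (lemma \<open>sum_levels_le_Lorentz_norm\<close>).

  \<^item> For \<open>s \<ge> u\<close> the maximal dyadic cubes making up \<open>V\<^sub>s\<close> have averages between \<open>s\<close> and \<open>2\<^sup>n s\<close>, where \<open>n\<close> is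
    the dimension. On each such cube \<open>R\<close> the hypothesis and the first fact, applied to the traces of \<open>V\<^sub>\<sigma>\<close> with
    \<open>\<sigma> = 2\<^sup>k s\<close>, bound \<open>\<Sum>\<^sub>k (2\<^sup>k s)\<^sup>q \<bar>V\<^sub>\<sigma> \<inter> R\<bar>\<^sup>r\<close> by \<open>C s\<^sup>q \<bar>R\<bar>\<^sup>r\<close>. As \<open>r \<ge> 1\<close>, convexity lets these
    local bounds be added up to \<open>\<Sum>\<^sub>k (2\<^sup>k s)\<^sup>q \<bar>V\<^sub>\<sigma>\<bar>\<^sup>r \<le> C s\<^sup>q \<bar>V\<^sub>s\<bar>\<^sup>r\<close> (lemma \<open>sum_levels_le\<close>).

  \<^item> So the terms \<open>b\<^sub>k = \<sigma>\<^sup>q \<bar>V\<^sub>\<sigma>\<bar>\<^sup>r\<close>, \<open>\<sigma> = 2\<^sup>k u\<close>, have every tail sum dominated by its first term, which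
    forces geometric decay (lemma \<open>geometric_decay\<close>). Since \<open>w \<le> \<sigma>\<close> almost everywhere outside \<open>V\<^sub>\<sigma>\<close>, the
    measure of \<open>{w > 2\<^sup>k u}\<close> is at most \<open>C \<theta>\<^sup>k 2\<^bsup>-kp\<^esup> \<bar>Q\<bar>\<close> with \<open>\<theta> < 1\<close>, and summing over
    the levels gives \<open>\<integral>\<^sub>Q w\<^sup>p \<le> C u\<^sup>p \<bar>Q\<bar>\<close> (lemma \<open>nn_integral_powr_le\<close>).

  The dyadic families are truncated at a generation \<open>M\<close>, which makes them finite; every constant is
  independent of \<open>M\<close>, and \<open>M \<rightarrow> \<infinity>\<close> is taken only in lemma \<open>emeasure_level_set_le\<close>.
\<close>

section \<open>Powers with values in the extended half-line and layer cakes\<close>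

lemma ennpowr_ennreal: "0 \<le> x \<Longrightarrow> ennpowr (ennreal x) r = ennreal (x powr r)"
  by (simp add: ennpowr_def)

lemma ennpowr_mono: "0 \<le> r \<Longrightarrow> x \<le> y \<Longrightarrow> ennpowr x r \<le> ennpowr y r"
  by (cases x; cases y) (auto simp: ennpowr_def top_unique intro!: ennreal_leI powr_mono2)

lemma ennpowr_inverse: "0 < r \<Longrightarrow> ennpowr (ennpowr x (1 / r)) r = x"
  by (cases x) (auto simp: ennpowr_def powr_powr)

lemma ennpowr_inverse': "0 < r \<Longrightarrow> ennpowr (ennpowr x r) (1 / r) = x"
  by (cases x) (auto simp: ennpowr_def powr_powr)

lemma sigma_finite_lebesgue: "sigma_finite_measure (lebesgue :: 'a::euclidean_space measure)"
proof
  obtain A :: "'a set set" where A: "countable A" "A \<subseteq> sets lborel" "\<Union>A = space lborel"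
      "\<forall>a\<in>A. emeasure lborel a \<noteq> \<infinity>"
    using lborel.sigma_finite_countable by blast
  then show "\<exists>A. countable A \<and> A \<subseteq> sets (lebesgue :: 'a measure) \<and> \<Union>A = space lebesgue \<and>
      (\<forall>a\<in>A. emeasure lebesgue a \<noteq> \<infinity>)"
    by (intro exI[of _ A]) (auto simp: emeasure_completion)
qed

text \<open>
  Tonelli is used below for a product of the domain of \<open>f\<close>, where \<open>f\<close> is only Lebesgue measurable, with
  the half-line of levels.
\<close>

interpretation lebesgue: sigma_finite_measure "lebesgue :: 'a::euclidean_space measure"
  by (rule sigma_finite_lebesgue)

interpretation lebesgue_lborel: pair_sigma_finite "lebesgue :: 'a::euclidean_space measure"
  "lborel :: real measure"
  ..

lemma emeasure_lborel_Ioi: "emeasure lborel {a<..} = (top :: ennreal)" for a :: real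
proof -
  have "of_nat n \<le> emeasure lborel {a<..}" for n :: nat
  proof -
    have "emeasure lborel {a<..<a + real n} \<le> emeasure lborel {a<..}"
      by (intro emeasure_mono) auto
    then show ?thesis
      by (simp add: ennreal_of_nat_eq_real_of_nat)
  qed
  then show ?thesis
    using ennreal_SUP_of_nat_eq_top by (metis SUP_least top_unique)
qed

lemma emeasure_lborel_less:
  "emeasure lborel {s. 0 < s \<and> ennreal s < x} = x"
proof (cases x)
  case (real r)
  then have "{s. 0 < s \<and> ennreal s < x} = {0<..<r}"
    by (auto simp: ennreal_less_iff)
  then show ?thesis using real by simp
next
  case top
  then have "{s. 0 < s \<and> ennreal s < x} = {0<..}"
    by auto
  then show ?thesis using top by (simp add: emeasure_lborel_Ioi)
qed

lemma emeasure_lborel_le: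
  "emeasure lborel {s. 0 < s \<and> ennreal s \<le> x} = x"
proof (cases x)
  case (real r)
  then have "{s. 0 < s \<and> ennreal s \<le> x} = {0<..r}"
    by auto
  then show ?thesis using real by simp
next
  case top
  then have "{s. 0 < s \<and> ennreal s \<le> x} = {0<..}"
    by auto
  then show ?thesis using top by (simp add: emeasure_lborel_Ioi)
qed

section \<open>The averaged rearrangement in terms of the distribution function\<close>

definition distribution_function :: "(real ^ 'n \<Rightarrow> real) \<Rightarrow> real \<Rightarrow> ennreal" where
  "distribution_function f s = emeasure lebesgue {x. s < \<bar>f x\<bar>}"

lemma distribution_function_nn_integral:
  assumes [measurable]: "f \<in> borel_measurable lebesgue"
  shows "distribution_function f s = (\<integral>\<^sup>+ x. indicator {y. y < \<bar>f x\<bar>} s \<partial>lebesgue)"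
proof -
  have "{x \<in> space lebesgue. s < \<bar>f x\<bar>} \<in> sets lebesgue"
    by measurable
  then have "emeasure lebesgue {x. s < \<bar>f x\<bar>} = (\<integral>\<^sup>+ x. indicator {x. s < \<bar>f x\<bar>} x \<partial>lebesgue)"
    by simp
  then show ?thesis
    by (simp add: distribution_function_def indicator_def)
qed

lemma measurable_distribution_function [measurable]:
  assumes [measurable]: "f \<in> borel_measurable lebesgue"
  shows "distribution_function f \<in> borel_measurable borel"
proof -
  have "(\<lambda>s. \<integral>\<^sup>+ x. indicator {y. y < \<bar>f x\<bar>} s \<partial>lebesgue) \<in> borel_measurable borel"
    unfolding indicator_def mem_Collect_eq by measurable
  then show ?thesis
    by (subst distribution_function_nn_integral[OF assms, abs_def])
qed

lemma less_distribution_function: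
  assumes "0 \<le> s" "ennreal s < rearrangement f t"
  shows "ennreal t < distribution_function f s"
proof (rule ccontr)
  assume "\<not> ennreal t < distribution_function f s"
  then have "emeasure lebesgue {x. ennreal s < ennreal \<bar>f x\<bar>} \<le> ennreal t"
    using assms(1) by (simp add: distribution_function_def ennreal_less_iff not_less)
  then have "rearrangement f t \<le> ennreal s"
    unfolding rearrangement_def by (intro Inf_lower) simp
  then show False using assms(2) by simp
qed

lemma le_rearrangement:
  assumes [measurable]: "f \<in> borel_measurable lebesgue"
    and "0 \<le> s" "ennreal t < distribution_function f s"
  shows "ennreal s \<le> rearrangement f t"
  unfolding rearrangement_def
proof (rule Inf_greatest)
  fix y assume "y \<in> {s. emeasure lebesgue {x. s < ennreal \<bar>f x\<bar>} \<le> ennreal t}"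
  then have y: "emeasure lebesgue {x. y < ennreal \<bar>f x\<bar>} \<le> ennreal t"
    by simp
  show "ennreal s \<le> y"
  proof (rule ccontr)
    assume "\<not> ennreal s \<le> y"
    have m: "{x \<in> space lebesgue. y < ennreal \<bar>f x\<bar>} \<in> sets lebesgue"
      by measurable
    have "distribution_function f s \<le> emeasure lebesgue {x. y < ennreal \<bar>f x\<bar>}"
      unfolding distribution_function_def
      using m \<open>\<not> ennreal s \<le> y\<close> \<open>0 \<le> s\<close>
      by (intro emeasure_mono) (auto simp: not_le intro: less_trans[OF _ ennreal_lessI])
    then show False
      using y assms(3) by simp
  qed
qed

text \<open>
  The level \<open>s\<close> lies below \<open>f\<^sup>*(t)\<close> exactly when \<open>t\<close> lies below the distribution function at \<open>s\<close>, up to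
  the single level \<open>s = f\<^sup>*(t)\<close>, which does not affect the integral.
\<close>

lemma rearrangement_layer_cake:
  assumes "f \<in> borel_measurable lebesgue"
  shows "rearrangement f t = (\<integral>\<^sup>+ s\<in>{0<..}. indicator {y. ennreal t < y} (distribution_function f s) \<partial>lborel)"
proof (rule antisym)
  have "rearrangement f t = (\<integral>\<^sup>+ s. indicator {s. 0 < s \<and> ennreal s < rearrangement f t} s \<partial>lborel)"
    by (subst nn_integral_indicator) (simp_all add: emeasure_lborel_less)
  also have "\<dots> \<le> (\<integral>\<^sup>+ s\<in>{0<..}. indicator {y. ennreal t < y} (distribution_function f s) \<partial>lborel)"
    by (intro nn_integral_mono) (auto simp: indicator_def intro: less_distribution_function)
  finally show "rearrangement f t \<le> \<dots>" .
next
  have "(\<integral>\<^sup>+ s\<in>{0<..}. indicator {y. ennreal t < y} (distribution_function f s) \<partial>lborel)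
      \<le> (\<integral>\<^sup>+ s. indicator {s. 0 < s \<and> ennreal s \<le> rearrangement f t} s \<partial>lborel)"
    using le_rearrangement[OF assms] by (intro nn_integral_mono) (auto simp: indicator_def)
  also have "\<dots> = rearrangement f t"
    by (subst nn_integral_indicator) (simp_all add: emeasure_lborel_le)
  finally show "\<dots> \<ge> (\<integral>\<^sup>+ s\<in>{0<..}. indicator {y. ennreal t < y} (distribution_function f s) \<partial>lborel)" .
qed

text \<open>
  This is the quantity \<open>t f\<^sup>*\<^sup>*(t) = \<integral>\<^sub>0\<^sup>t f\<^sup>*\<close>. As an integral over levels it is monotone and concave in \<open>t\<close> at
  sight, and it needs no rearrangement.
\<close>

definition truncated_mass :: "(real ^ 'n \<Rightarrow> real) \<Rightarrow> real \<Rightarrow> ennreal" where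
  "truncated_mass f t = (\<integral>\<^sup>+ s\<in>{0<..}. min (ennreal t) (distribution_function f s) \<partial>lborel)"

lemma rearrangement_avg_eq:
  assumes [measurable]: "f \<in> borel_measurable lebesgue"
  shows "rearrangement_avg f t = truncated_mass f t / ennreal t"
proof -
  have "(\<integral>\<^sup>+ \<tau>\<in>{0<..<t}. rearrangement f \<tau> \<partial>lborel) =
      (\<integral>\<^sup>+ \<tau>. \<integral>\<^sup>+ s. indicator {y. ennreal \<tau> < y} (distribution_function f s) * indicator {0<..} s
         * indicator {0<..<t} \<tau> \<partial>lborel \<partial>lborel)"
    unfolding rearrangement_layer_cake[OF assms] indicator_def mem_Collect_eq
    by (intro nn_integral_cong nn_integral_multc[symmetric]) measurable
  also have "\<dots> = (\<integral>\<^sup>+ s. \<integral>\<^sup>+ \<tau>. indicator {y. ennreal \<tau> < y} (distribution_function f s) * indicator {0<..} s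
         * indicator {0<..<t} \<tau> \<partial>lborel \<partial>lborel)"
    unfolding indicator_def mem_Collect_eq
    by (rule lborel_pair.Fubini'[symmetric]) measurable
  also have "\<dots> = truncated_mass f t"
    unfolding truncated_mass_def
  proof (intro nn_integral_cong)
    fix s
    have "(\<integral>\<^sup>+ \<tau>. indicator {y. ennreal \<tau> < y} (distribution_function f s) * indicator {0<..} s
         * indicator {0<..<t} \<tau> \<partial>lborel) =
        (\<integral>\<^sup>+ \<tau>. indicator {\<tau>. 0 < \<tau> \<and> ennreal \<tau> < min (ennreal t) (distribution_function f s)} \<tau>
          * indicator {0<..} s \<partial>lborel)"
      by (intro nn_integral_cong) (auto simp: indicator_def ennreal_less_iff)
    also have "\<dots> = min (ennreal t) (distribution_function f s) * indicator {0<..} s"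
    proof (subst nn_integral_multc)
      have *: "{\<tau>. 0 < \<tau> \<and> ennreal \<tau> < min (ennreal t) (distribution_function f s)} \<in> sets lborel"
        by measurable
      then show "indicator {\<tau>. 0 < \<tau> \<and> ennreal \<tau> < min (ennreal t) (distribution_function f s)}
          \<in> borel_measurable lborel"
        by (rule borel_measurable_indicator)
      show "integral\<^sup>N lborel
          (indicator {\<tau>. 0 < \<tau> \<and> ennreal \<tau> < min (ennreal t) (distribution_function f s)})
          * indicator {0<..} s = min (ennreal t) (distribution_function f s) * indicator {0<..} s"
        unfolding nn_integral_indicator[OF *] emeasure_lborel_less ..
    qed
    finally show "(\<integral>\<^sup>+ \<tau>. indicator {y. ennreal \<tau> < y} (distribution_function f s) * indicator {0<..} s
         * indicator {0<..<t} \<tau> \<partial>lborel) = min (ennreal t) (distribution_function f s) * indicator {0<..} s" .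
  qed
  finally show ?thesis
    by (simp add: rearrangement_avg_def)
qed

lemma measurable_ennpowr [measurable]: "(\<lambda>x. ennpowr x r) \<in> borel_measurable borel"
  unfolding ennpowr_def by measurable

lemma measurable_truncated_mass [measurable]:
  assumes [measurable]: "f \<in> borel_measurable lebesgue"
  shows "truncated_mass f \<in> borel_measurable borel"
  unfolding truncated_mass_def[abs_def] by measurable

lemma measurable_rearrangement_avg [measurable]:
  assumes [measurable]: "f \<in> borel_measurable lebesgue"
  shows "rearrangement_avg f \<in> borel_measurable borel"
  unfolding rearrangement_avg_eq[OF assms, abs_def] by measurable

lemma Lorentz_norm_powr:
  assumes "0 < q"
  shows "ennpowr (Lorentz_norm p q f) q =
    (\<integral>\<^sup>+ t\<in>{0<..}. ennpowr (rearrangement_avg f t) q * ennreal (t powr (q / p - 1)) \<partial>lborel)"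
proof -
  have "ennpowr (rearrangement_avg f t) q * ennreal (t powr (q / p)) / ennreal t =
      ennpowr (rearrangement_avg f t) q * ennreal (t powr (q / p - 1))" if "0 < t" for t
    using that by (simp add: ennreal_times_divide[symmetric] divide_ennreal powr_diff)
  then show ?thesis
    unfolding Lorentz_norm_def ennpowr_inverse[OF assms]
    by (intro nn_integral_cong) (auto simp: indicator_def)
qed

section \<open>The Lorentz norm is controlled by the Lebesgue norm\<close>

text \<open>
  The levels below \<open>s\<close> contribute at most \<open>t s\<close>, and those above \<open>s\<close> contribute at most the integral of
  \<open>\<bar>f\<bar>\<close> where \<open>\<bar>f\<bar> > s\<close>.
\<close>

lemma truncated_mass_le:
  assumes [measurable]: "f \<in> borel_measurable lebesgue" and "0 \<le> s" "0 \<le> t"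
  shows "truncated_mass f t \<le> ennreal (t * s) + (\<integral>\<^sup>+ x. ennreal \<bar>f x\<bar> * indicator {s<..} \<bar>f x\<bar> \<partial>lebesgue)"
proof -
  have "truncated_mass f t \<le> (\<integral>\<^sup>+ \<sigma>. ennreal t * indicator {0..s} \<sigma> + 
      distribution_function f \<sigma> * indicator {s<..} \<sigma> \<partial>lborel)"
    unfolding truncated_mass_def by (intro nn_integral_mono) (auto simp: indicator_def)
  also have "\<dots> = ennreal t * ennreal s + (\<integral>\<^sup>+ \<sigma>\<in>{s<..}. distribution_function f \<sigma> \<partial>lborel)"
    using assms by (subst nn_integral_add) (auto simp: nn_integral_cmult_indicator)
  also have "(\<integral>\<^sup>+ \<sigma>\<in>{s<..}. distribution_function f \<sigma> \<partial>lborel) =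
      (\<integral>\<^sup>+ \<sigma>. \<integral>\<^sup>+ x. indicator {y. y < \<bar>f x\<bar>} \<sigma> * indicator {s<..} \<sigma> \<partial>lebesgue \<partial>lborel)"
    unfolding distribution_function_nn_integral[OF assms(1)] indicator_def mem_Collect_eq
    by (intro nn_integral_cong nn_integral_multc[symmetric]) measurable
  also have "\<dots> = (\<integral>\<^sup>+ x. \<integral>\<^sup>+ \<sigma>. indicator {y. y < \<bar>f x\<bar>} \<sigma> * indicator {s<..} \<sigma> \<partial>lborel \<partial>lebesgue)"
    unfolding indicator_def mem_Collect_eq
    by (rule lebesgue_lborel.Fubini') measurable
  also have "\<dots> \<le> (\<integral>\<^sup>+ x. ennreal \<bar>f x\<bar> * indicator {s<..} \<bar>f x\<bar> \<partial>lebesgue)"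
  proof (intro nn_integral_mono)
    fix x
    have "(\<integral>\<^sup>+ \<sigma>. indicator {y. y < \<bar>f x\<bar>} \<sigma> * indicator {s<..} \<sigma> \<partial>lborel) =
        (\<integral>\<^sup>+ \<sigma>. indicator {s<..<\<bar>f x\<bar>} \<sigma> \<partial>lborel)"
      by (intro nn_integral_cong) (auto simp: indicator_def)
    also have "\<dots> = emeasure lborel {s<..<\<bar>f x\<bar>}"
      by simp
    also have "\<dots> \<le> ennreal \<bar>f x\<bar> * indicator {s<..} \<bar>f x\<bar>"
      using \<open>0 \<le> s\<close> by (cases "s < \<bar>f x\<bar>") (auto simp: indicator_def intro!: ennreal_leI)
    finally show "(\<integral>\<^sup>+ \<sigma>. indicator {y. y < \<bar>f x\<bar>} \<sigma> * indicator {s<..} \<sigma> \<partial>lborel) \<le> \<dots>" .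
  qed
  finally show ?thesis
    using assms by (simp add: ennreal_mult)
qed

lemma nn_integral_powr_Ioo:
  assumes "0 < e" "0 \<le> X"
  shows "(\<integral>\<^sup>+ s\<in>{0<..<X}. ennreal (s powr (e - 1)) \<partial>lborel) = ennreal (X powr e / e)"
proof -
  have "((\<lambda>s. s powr (e - 1)) has_integral (X powr e / e)) {0..X}"
    using has_integral_powr_from_0[of "e - 1" X] assms by simp
  then have "(\<integral>\<^sup>+ s\<in>{0..X}. ennreal (s powr (e - 1)) \<partial>lborel) = ennreal (X powr e / e)"
    by (intro nn_integral_has_integral_lebesgue') auto
  also have "(\<integral>\<^sup>+ s\<in>{0..X}. ennreal (s powr (e - 1)) \<partial>lborel) =
      (\<integral>\<^sup>+ s\<in>{0<..<X}. ennreal (s powr (e - 1)) \<partial>lborel)"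
  proof (rule nn_integral_cong_AE)
    have "AE s in lborel. s \<noteq> X"
      by (rule AE_lborel_singleton)
    then show "AE s in lborel. ennreal (s powr (e - 1)) * indicator {0..X} s =
        ennreal (s powr (e - 1)) * indicator {0<..<X} s"
      by eventually_elim (auto simp: indicator_def)
  qed
  finally show ?thesis .
qed

text \<open>
  The level \<open>s\<close> with \<open>s\<^sup>p = I / t\<close> balances the two terms of \<open>truncated_mass_le\<close>: where \<open>\<bar>f\<bar> > s\<close>, the
  function is at most \<open>\<bar>f\<bar>\<^sup>p\<close> times \<open>s\<close> to the power \<open>1 - p\<close>, so both terms are at most \<open>t s\<close>.
\<close>

lemma rearrangement_avg_powr_le:
  assumes f: "f \<in> borel_measurable lebesgue" and "1 < p" "0 < I" "0 < t"
    and I: "(\<integral>\<^sup>+ x. ennreal (\<bar>f x\<bar> powr p) \<partial>lebesgue) \<le> ennreal I"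
  shows "ennpowr (rearrangement_avg f t) p \<le> ennreal (2 powr p * I / t)"
proof -
  note [measurable] = f
  define s where "s = (I / t) powr (1 / p)"
  have s: "0 < s" "s powr p = I / t"
    using assms(2-4) by (auto simp: s_def powr_powr)
  have "(\<integral>\<^sup>+ x. ennreal \<bar>f x\<bar> * indicator {s<..} \<bar>f x\<bar> \<partial>lebesgue) \<le>
      (\<integral>\<^sup>+ x. ennreal (s powr (1 - p)) * ennreal (\<bar>f x\<bar> powr p) \<partial>lebesgue)"
  proof (intro nn_integral_mono)
    fix x
    have "\<bar>f x\<bar> \<le> s powr (1 - p) * \<bar>f x\<bar> powr p" if "s < \<bar>f x\<bar>"
    proof -
      have "\<bar>f x\<bar> = \<bar>f x\<bar> powr (1 - p) * \<bar>f x\<bar> powr p"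
        using that s by (simp add: powr_add[symmetric])
      also have "\<dots> \<le> s powr (1 - p) * \<bar>f x\<bar> powr p"
        using that s assms(2) by (intro mult_right_mono powr_mono2') auto
      finally show ?thesis .
    qed
    then show "ennreal \<bar>f x\<bar> * indicator {s<..} \<bar>f x\<bar> \<le> ennreal (s powr (1 - p)) * ennreal (\<bar>f x\<bar> powr p)"
      by (auto simp: indicator_def ennreal_mult[symmetric] intro: ennreal_leI)
  qed
  also have "\<dots> = ennreal (s powr (1 - p)) * (\<integral>\<^sup>+ x. ennreal (\<bar>f x\<bar> powr p) \<partial>lebesgue)"
    by (rule nn_integral_cmult) measurable
  also have "\<dots> \<le> ennreal (s powr (1 - p)) * ennreal I"
    by (intro mult_left_mono I) simp
  also have "\<dots> = ennreal (t * s)"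
  proof -
    have "I = t * s powr p"
      using s assms(4) by simp
    then have "s powr (1 - p) * I = t * s"
      using s(1) by (simp add: powr_add[symmetric])
    then show ?thesis
      using assms(3) by (simp add: ennreal_mult[symmetric])
  qed
  finally have "truncated_mass f t \<le> ennreal (t * s) + ennreal (t * s)"
    using truncated_mass_le[OF f, of s t] s assms(4) by (meson add_left_mono less_imp_le order_trans)
  then have "rearrangement_avg f t \<le> ennreal (2 * s * t) / ennreal t"
    unfolding rearrangement_avg_eq[OF f] using s assms(4)
    by (intro divide_right_mono_ennreal) (simp add: ennreal_plus[symmetric] mult_ac del: ennreal_plus)
  also have "\<dots> = ennreal (2 * s)"
    using s assms(4) by (simp add: divide_ennreal)
  finally have "ennpowr (rearrangement_avg f t) p \<le> ennpowr (ennreal (2 * s)) p"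
    using assms(2) by (intro ennpowr_mono) auto
  also have "\<dots> = ennreal (2 powr p * I / t)"
    using s by (simp add: ennpowr_ennreal powr_mult)
  finally show ?thesis .
qed

text \<open>
  If \<open>f\<^sup>*\<^sup>*(t) > s\<close>, the decomposition at level \<open>s / 2\<close> absorbs half of \<open>t s\<close> and leaves
  \<open>t s / 2 \<le> \<integral>\<^bsub>{\<bar>f\<bar> > s / 2}\<^esub> \<bar>f\<bar>\<close>.
\<close>

lemma emeasure_rearrangement_avg_gt_le:
  assumes f: "f \<in> borel_measurable lebesgue" and "0 < s"
  shows "emeasure lborel {t. 0 < t \<and> ennreal s < rearrangement_avg f t}
    \<le> ennreal (2 / s) * (\<integral>\<^sup>+ x. ennreal \<bar>f x\<bar> * indicator {s / 2<..} \<bar>f x\<bar> \<partial>lebesgue)" (is "_ \<le> ennreal (2 / s) * ?N")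
proof -
  have "ennreal t \<le> ennreal (2 / s) * ?N" if t: "0 < t" "ennreal s < rearrangement_avg f t" for t
  proof -
    have "ennreal (s / 2 * t) + ennreal (s / 2 * t) = ennreal s * ennreal t"
      using \<open>0 < s\<close> t by (simp add: ennreal_plus[symmetric] ennreal_mult[symmetric] del: ennreal_plus)
    also have "\<dots> \<le> rearrangement_avg f t * ennreal t"
      using t by (intro mult_right_mono) auto
    also have "\<dots> = truncated_mass f t"
      using t unfolding rearrangement_avg_eq[OF f] by (simp add: ennreal_divide_times)
    also have "\<dots> \<le> ennreal (s / 2 * t) + ?N"
      using truncated_mass_le[OF f, of "s / 2" t] t \<open>0 < s\<close> by (simp add: mult.commute)
    finally have "ennreal (s / 2 * t) \<le> ?N"
      by (simp add: ennreal_add_left_cancel_le)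
    then have "ennreal (2 / s) * ennreal (s / 2 * t) \<le> ennreal (2 / s) * ?N"
      by (rule mult_left_mono) simp
    moreover have "ennreal (2 / s) * ennreal (s / 2 * t) = ennreal t"
      using \<open>0 < s\<close> t by (simp add: ennreal_mult[symmetric])
    ultimately show ?thesis by simp
  qed
  then have "emeasure lborel {t. 0 < t \<and> ennreal s < rearrangement_avg f t} \<le>
      emeasure lborel {t. 0 < t \<and> ennreal t \<le> ennreal (2 / s) * ?N}"
    by (intro emeasure_mono) auto
  then show ?thesis
    by (simp only: emeasure_lborel_le)
qed

text \<open>
  The Hardy inequality, by Marcinkiewicz interpolation: the left-hand side is the integral of
  \<open>p s\<^bsup>p - 1\<^esup>\<close> against the measure of \<open>{f\<^sup>*\<^sup>* > s}\<close>, the preceding estimate bounds that measure, and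
  interchanging the integrals leaves \<open>\<integral> s\<^bsup>p - 2\<^esup> ds\<close> over \<open>0 < s < 2 \<bar>f x\<bar>\<close>, which converges because \<open>p > 1\<close>.
\<close>

lemma nn_integral_rearrangement_avg_powr_le:
  assumes f: "f \<in> borel_measurable lebesgue" and "1 < p"
    and fin: "\<And>t. 0 < t \<Longrightarrow> rearrangement_avg f t \<noteq> top"
  shows "(\<integral>\<^sup>+ t\<in>{0<..}. ennpowr (rearrangement_avg f t) p \<partial>lborel)
    \<le> ennreal (p * 2 powr p / (p - 1)) * (\<integral>\<^sup>+ x. ennreal (\<bar>f x\<bar> powr p) \<partial>lebesgue)"
proof -
  note [measurable] = f
  let ?F = "rearrangement_avg f"
  have layer: "ennpowr (?F t) p = (\<integral>\<^sup>+ s. ennreal (p * s powr (p - 1)) * indicator {s. 0 < s \<and> ennreal s < ?F t} s \<partial>lborel)"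
    if "0 < t" for t
  proof (cases "?F t")
    case (real F)
    then have "{s. 0 < s \<and> ennreal s < ?F t} = {0<..<F}"
      by (auto simp: ennreal_less_iff)
    then have "(\<integral>\<^sup>+ s. ennreal (p * s powr (p - 1)) * indicator {s. 0 < s \<and> ennreal s < ?F t} s \<partial>lborel) =
        (\<integral>\<^sup>+ s. ennreal p * (ennreal (s powr (p - 1)) * indicator {0<..<F} s) \<partial>lborel)"
      using \<open>1 < p\<close> by (intro nn_integral_cong) (auto simp: ennreal_mult indicator_def)
    also have "\<dots> = ennreal p * ennreal (F powr p / p)"
      using \<open>1 < p\<close> real(1) by (subst nn_integral_cmult) (auto simp: nn_integral_powr_Ioo)
    also have "\<dots> = ennpowr (?F t) p"
      using \<open>1 < p\<close> real by (simp add: ennpowr_ennreal ennreal_mult[symmetric])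
    finally show ?thesis ..
  qed (use fin[OF that] in simp)
  have "(\<integral>\<^sup>+ t\<in>{0<..}. ennpowr (?F t) p \<partial>lborel) =
      (\<integral>\<^sup>+ t. \<integral>\<^sup>+ s. ennreal (p * s powr (p - 1)) * indicator {s. 0 < s \<and> ennreal s < ?F t} s * indicator {0<..} t \<partial>lborel \<partial>lborel)"
  proof (intro nn_integral_cong)
    fix t :: real
    show "ennpowr (?F t) p * indicator {0<..} t =
        (\<integral>\<^sup>+ s. ennreal (p * s powr (p - 1)) * indicator {s. 0 < s \<and> ennreal s < ?F t} s * indicator {0<..} t \<partial>lborel)"
      by (cases "0 < t") (auto simp: layer)
  qed
  also have "\<dots> = (\<integral>\<^sup>+ s. \<integral>\<^sup>+ t. ennreal (p * s powr (p - 1)) * indicator {s. 0 < s \<and> ennreal s < ?F t} s * indicator {0<..} t \<partial>lborel \<partial>lborel)"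
    unfolding indicator_def mem_Collect_eq
    by (rule lborel_pair.Fubini'[symmetric]) measurable
  also have "\<dots> \<le> (\<integral>\<^sup>+ s. \<integral>\<^sup>+ x. ennreal (2 * p * s powr (p - 2)) * indicator {0<..} s *
      (ennreal \<bar>f x\<bar> * indicator {s / 2<..} \<bar>f x\<bar>) \<partial>lebesgue \<partial>lborel)"
  proof (intro nn_integral_mono)
    fix s :: real
    let ?S = "{t. 0 < t \<and> ennreal s < ?F t}" and ?N = "\<integral>\<^sup>+ x. ennreal \<bar>f x\<bar> * indicator {s / 2<..} \<bar>f x\<bar> \<partial>lebesgue"
    have S: "?S \<in> sets lborel"
      by measurable
    have "(\<integral>\<^sup>+ t. ennreal (p * s powr (p - 1)) * indicator {s. 0 < s \<and> ennreal s < ?F t} s * indicator {0<..} t \<partial>lborel) =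
        (\<integral>\<^sup>+ t. ennreal (p * s powr (p - 1)) * indicator {0<..} s * indicator ?S t \<partial>lborel)"
      by (intro nn_integral_cong) (auto simp: indicator_def)
    also have "\<dots> = ennreal (p * s powr (p - 1)) * indicator {0<..} s * emeasure lborel ?S"
      using S by (rule nn_integral_cmult_indicator)
    also have "\<dots> \<le> ennreal (2 * p * s powr (p - 2)) * indicator {0<..} s * ?N"
    proof (cases "0 < s")
      case True
      have "ennreal (p * s powr (p - 1)) * emeasure lborel ?S \<le> ennreal (p * s powr (p - 1)) * (ennreal (2 / s) * ?N)"
        by (intro mult_left_mono emeasure_rearrangement_avg_gt_le f True) simp
      also have "\<dots> = ennreal (2 * p * s powr (p - 2)) * ?N"
      proof -
        have "p * s powr (p - 1) * (2 / s) = 2 * p * s powr (p - 2)"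
          using True by (simp add: powr_diff power2_eq_square)
        then show ?thesis
          using True \<open>1 < p\<close> by (simp add: mult.assoc[symmetric] ennreal_mult[symmetric])
      qed
      finally show ?thesis using True by simp
    qed simp
    also have "\<dots> = (\<integral>\<^sup>+ x. ennreal (2 * p * s powr (p - 2)) * indicator {0<..} s *
      (ennreal \<bar>f x\<bar> * indicator {s / 2<..} \<bar>f x\<bar>) \<partial>lebesgue)"
      by (rule nn_integral_cmult[symmetric]) measurable
    finally show "(\<integral>\<^sup>+ t. ennreal (p * s powr (p - 1)) * indicator {s. 0 < s \<and> ennreal s < ?F t} s * indicator {0<..} t \<partial>lborel) \<le> \<dots>" .
  qed
  also have "\<dots> = (\<integral>\<^sup>+ x. \<integral>\<^sup>+ s. ennreal (2 * p * s powr (p - 2)) * indicator {0<..} s *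
      (ennreal \<bar>f x\<bar> * indicator {s / 2<..} \<bar>f x\<bar>) \<partial>lborel \<partial>lebesgue)"
    unfolding indicator_def greaterThan_iff
    by (rule lebesgue_lborel.Fubini') measurable
  also have "\<dots> = (\<integral>\<^sup>+ x. ennreal (p * 2 powr p / (p - 1)) * ennreal (\<bar>f x\<bar> powr p) \<partial>lebesgue)"
  proof (intro nn_integral_cong)
    fix x
    have "(\<integral>\<^sup>+ s. ennreal (2 * p * s powr (p - 2)) * indicator {0<..} s *
      (ennreal \<bar>f x\<bar> * indicator {s / 2<..} \<bar>f x\<bar>) \<partial>lborel) =
        (\<integral>\<^sup>+ s. ennreal (2 * p * \<bar>f x\<bar>) * (ennreal (s powr (p - 1 - 1)) * indicator {0<..<2 * \<bar>f x\<bar>} s) \<partial>lborel)"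
      using \<open>1 < p\<close> by (intro nn_integral_cong) (auto simp: indicator_def ennreal_mult[symmetric] mult_ac)
    also have "\<dots> = ennreal (2 * p * \<bar>f x\<bar>) * ennreal ((2 * \<bar>f x\<bar>) powr (p - 1) / (p - 1))"
      using \<open>1 < p\<close> by (subst nn_integral_cmult) (simp_all only: nn_integral_powr_Ioo, simp_all)
    also have "\<dots> = ennreal (p * 2 powr p / (p - 1)) * ennreal (\<bar>f x\<bar> powr p)"
    proof -
      have "2 * p * \<bar>f x\<bar> * ((2 * \<bar>f x\<bar>) powr (p - 1) / (p - 1)) = p * 2 powr p / (p - 1) * \<bar>f x\<bar> powr p"
        by (cases "f x = 0") (auto simp: powr_mult powr_diff)
      then show ?thesis
        using \<open>1 < p\<close> by (simp add: ennreal_mult[symmetric])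
    qed
    finally show "(\<integral>\<^sup>+ s. ennreal (2 * p * s powr (p - 2)) * indicator {0<..} s *
      (ennreal \<bar>f x\<bar> * indicator {s / 2<..} \<bar>f x\<bar>) \<partial>lborel) = \<dots>" .
  qed
  also have "\<dots> = ennreal (p * 2 powr p / (p - 1)) * (\<integral>\<^sup>+ x. ennreal (\<bar>f x\<bar> powr p) \<partial>lebesgue)"
    by (rule nn_integral_cmult) measurable
  finally show ?thesis .
qed

text \<open>
  The weak-type bound turns the surplus factor in \<open>f\<^sup>*\<^sup>*(t)\<^sup>q t\<^bsup>r - 1\<^esup>\<close>, \<open>r = q / p\<close>, into a power of \<open>I\<close>, because
  \<open>f\<^sup>*\<^sup>*(t)\<^sup>q t\<^bsup>r - 1\<^esup> = f\<^sup>*\<^sup>*(t)\<^sup>p (f\<^sup>*\<^sup>*(t)\<^sup>p t)\<^bsup>r - 1\<^esup>\<close>; the remaining factor is integrated by the Hardy inequality.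
\<close>

lemma Lorentz_norm_le:
  assumes f: "f \<in> borel_measurable lebesgue" and p: "1 < p" "p \<le> q" and "0 < I"
    and I: "(\<integral>\<^sup>+ x. ennreal (\<bar>f x\<bar> powr p) \<partial>lebesgue) \<le> ennreal I"
  shows "Lorentz_norm p q f \<le> ennreal ((2 powr (q - p) * (p * 2 powr p / (p - 1))) powr (1 / q) * I powr (1 / p))"
proof -
  note [measurable] = f
  let ?F = "rearrangement_avg f"
  define c where "c = p * 2 powr p / (p - 1)"
  have c: "0 < c"
    using p by (simp add: c_def)
  have weak: "ennpowr (?F t) p \<le> ennreal (2 powr p * I / t)" if "0 < t" for t
    using rearrangement_avg_powr_le[OF f p(1) \<open>0 < I\<close> that I] .
  have fin: "?F t \<noteq> top" if "0 < t" for t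
    using weak[OF that] by (auto simp: ennpowr_def top_unique)
  have pointwise: "ennpowr (?F t) q * ennreal (t powr (q / p - 1)) \<le> ennreal ((2 powr p * I) powr (q / p - 1)) * ennpowr (?F t) p"
    if "0 < t" for t
  proof (cases "?F t")
    case (real F)
    have F: "F powr p \<le> 2 powr p * I / t"
      using weak[OF that] real \<open>0 < I\<close> that by (simp add: ennpowr_ennreal)
    have "F powr q * t powr (q / p - 1) = F powr p * (F powr p * t) powr (q / p - 1)"
      using that real(1) p by (simp add: powr_mult powr_powr powr_add[symmetric] right_diff_distrib)
    also have "\<dots> \<le> F powr p * (2 powr p * I) powr (q / p - 1)"
      using F that p by (intro mult_left_mono powr_mono2) (auto simp: pos_le_divide_eq)
    finally show ?thesis
      using real by (simp add: ennpowr_ennreal ennreal_mult[symmetric] mult.commute ennreal_leI)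
  qed (use fin[OF that] in simp)
  have "ennpowr (Lorentz_norm p q f) q = (\<integral>\<^sup>+ t\<in>{0<..}. ennpowr (?F t) q * ennreal (t powr (q / p - 1)) \<partial>lborel)"
    using p by (intro Lorentz_norm_powr) simp
  also have "\<dots> \<le> (\<integral>\<^sup>+ t. ennreal ((2 powr p * I) powr (q / p - 1)) * (ennpowr (?F t) p * indicator {0<..} t) \<partial>lborel)"
    using pointwise by (intro nn_integral_mono) (auto simp: indicator_def)
  also have "\<dots> = ennreal ((2 powr p * I) powr (q / p - 1)) * (\<integral>\<^sup>+ t\<in>{0<..}. ennpowr (?F t) p \<partial>lborel)"
    by (rule nn_integral_cmult) measurable
  also have "\<dots> \<le> ennreal ((2 powr p * I) powr (q / p - 1)) * (ennreal c * ennreal I)"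
    using nn_integral_rearrangement_avg_powr_le[OF f p(1) fin] mult_left_mono[OF I, of "ennreal c"]
    by (intro mult_left_mono) (auto simp: c_def intro: order_trans)
  also have "\<dots> = ennreal (2 powr (q - p) * c * I powr (q / p))"
  proof -
    have "(2 powr p * I) powr (q / p - 1) * (c * I) = 2 powr (q - p) * c * I powr (q / p)"
      using \<open>0 < I\<close> p by (simp add: powr_mult powr_powr powr_diff right_diff_distrib)
    then show ?thesis
      using \<open>0 < I\<close> c by (simp add: ennreal_mult[symmetric])
  qed
  finally have "ennpowr (ennpowr (Lorentz_norm p q f) q) (1 / q) \<le> ennpowr (ennreal (2 powr (q - p) * c * I powr (q / p))) (1 / q)"
    using p by (intro ennpowr_mono) auto
  also have "\<dots> = ennreal ((2 powr (q - p) * c) powr (1 / q) * I powr (1 / p))"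
    using p c \<open>0 < I\<close> by (simp add: ennpowr_ennreal powr_mult powr_powr)
  finally show ?thesis
    using p by (simp add: ennpowr_inverse' c_def)
qed

section \<open>Level sets controlled by the Lorentz norm\<close>

text \<open>
  The Hardy--Littlewood inequality: the part of \<open>{\<bar>f\<bar> > s}\<close> in \<open>E\<close> has measure at most that of either set.
\<close>

lemma nn_integral_le_truncated_mass:
  assumes [measurable]: "f \<in> borel_measurable lebesgue" and E: "E \<in> lmeasurable"
  shows "(\<integral>\<^sup>+ x\<in>E. ennreal \<bar>f x\<bar> \<partial>lebesgue) \<le> truncated_mass f (measure lebesgue E)"
proof -
  have [measurable]: "E \<in> sets lebesgue"
    using E by auto
  have "(\<integral>\<^sup>+ x\<in>E. ennreal \<bar>f x\<bar> \<partial>lebesgue) =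
      (\<integral>\<^sup>+ x. \<integral>\<^sup>+ s. indicator {s. 0 < s \<and> s < \<bar>f x\<bar>} s * indicator E x \<partial>lborel \<partial>lebesgue)"
  proof (intro nn_integral_cong)
    fix x
    have "{s. 0 < s \<and> s < \<bar>f x\<bar>} = {0<..<\<bar>f x\<bar>}"
      by auto
    then show "ennreal \<bar>f x\<bar> * indicator E x =
        (\<integral>\<^sup>+ s. indicator {s. 0 < s \<and> s < \<bar>f x\<bar>} s * indicator E x \<partial>lborel)"
      by (simp add: nn_integral_multc)
  qed
  also have "\<dots> = (\<integral>\<^sup>+ s. \<integral>\<^sup>+ x. indicator {s. 0 < s \<and> s < \<bar>f x\<bar>} s * indicator E x \<partial>lebesgue \<partial>lborel)"
    unfolding indicator_def mem_Collect_eq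
    by (rule lebesgue_lborel.Fubini'[symmetric]) measurable
  also have "\<dots> \<le> truncated_mass f (measure lebesgue E)"
    unfolding truncated_mass_def
  proof (intro nn_integral_mono)
    fix s :: real
    have [measurable]: "{x \<in> space lebesgue. s < \<bar>f x\<bar>} \<in> sets lebesgue"
      by measurable
    have "(\<integral>\<^sup>+ x. indicator {s. 0 < s \<and> s < \<bar>f x\<bar>} s * indicator E x \<partial>lebesgue) =
        (\<integral>\<^sup>+ x. indicator ({x. s < \<bar>f x\<bar>} \<inter> E) x * indicator {0<..} s \<partial>lebesgue)"
      by (intro nn_integral_cong) (auto simp: indicator_def)
    also have "\<dots> = emeasure lebesgue ({x. s < \<bar>f x\<bar>} \<inter> E) * indicator {0<..} s"
      by (subst nn_integral_multc) (use \<open>{x \<in> space lebesgue. s < \<bar>f x\<bar>} \<in> sets lebesgue\<close> in auto)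
    also have "\<dots> \<le> min (ennreal (measure lebesgue E)) (distribution_function f s) * indicator {0<..} s"
    proof (intro mult_right_mono min.boundedI)
      have "emeasure lebesgue ({x. s < \<bar>f x\<bar>} \<inter> E) \<le> emeasure lebesgue E"
        by (intro emeasure_mono) auto
      then show "emeasure lebesgue ({x. s < \<bar>f x\<bar>} \<inter> E) \<le> ennreal (measure lebesgue E)"
        using E by (simp add: emeasure_eq_measure2)
      show "emeasure lebesgue ({x. s < \<bar>f x\<bar>} \<inter> E) \<le> distribution_function f s"
        unfolding distribution_function_def
        using \<open>{x \<in> space lebesgue. s < \<bar>f x\<bar>} \<in> sets lebesgue\<close> by (intro emeasure_mono) auto
    qed simp
    finally show "(\<integral>\<^sup>+ x. indicator {s. 0 < s \<and> s < \<bar>f x\<bar>} s * indicator E x \<partial>lebesgue) \<le> \<dots>" .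
  qed
  finally show ?thesis .
qed

text \<open>
  A concave function that vanishes at \<open>0\<close>; under the integral this is \<open>(t / T) min T d \<le> min t d\<close>.
\<close>

lemma truncated_mass_concave:
  assumes [measurable]: "f \<in> borel_measurable lebesgue" and "0 < t" "t \<le> T"
  shows "ennreal (t / T) * truncated_mass f T \<le> truncated_mass f t"
proof -
  have "ennreal (t / T) * truncated_mass f T =
      (\<integral>\<^sup>+ s. ennreal (t / T) * (min (ennreal T) (distribution_function f s) * indicator {0<..} s) \<partial>lborel)"
    unfolding truncated_mass_def by (intro nn_integral_cmult[symmetric]) measurable
  also have "\<dots> \<le> truncated_mass f t"
    unfolding truncated_mass_def
  proof (intro nn_integral_mono)
    fix s :: real
    have "ennreal (t / T) * min (ennreal T) d \<le> min (ennreal t) d" for d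
    proof (cases d)
      case (real r)
      have "t / T * min T r \<le> min t r"
        using assms(2,3) real(1) mult_left_le_one_le[of r "t / T"]
        by (auto simp: min_def field_simps mult_le_cancel_right)
      then show ?thesis
        using real assms(2,3) by (simp add: min_ennreal ennreal_mult[symmetric] ennreal_leI)
    next
      case top
      then show ?thesis using assms(2,3) by (simp add: ennreal_mult[symmetric])
    qed
    from mult_right_mono[OF this, of "indicator {0<..} s" "distribution_function f s"]
    show "ennreal (t / T) * (min (ennreal T) (distribution_function f s) * indicator {0<..} s)
        \<le> min (ennreal t) (distribution_function f s) * indicator {0<..} s"
      by (simp add: mult.assoc)
  qed
  finally show ?thesis .
qed

text \<open>
  A set on which \<open>\<bar>f\<bar>\<close> has average at least \<open>\<sigma>\<close> keeps \<open>f\<^sup>*\<^sup>*\<close> above \<open>\<sigma>\<close> up to the measure of the set, and not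
  only at that point, because \<open>f\<^sup>*\<^sup>*\<close> is nonincreasing.
\<close>

lemma le_rearrangement_avg:
  assumes f: "f \<in> borel_measurable lebesgue" and E: "E \<in> lmeasurable"
    and "0 \<le> \<sigma>" and avg: "ennreal (\<sigma> * measure lebesgue E) \<le> (\<integral>\<^sup>+ x\<in>E. ennreal \<bar>f x\<bar> \<partial>lebesgue)"
    and t: "0 < t" "t \<le> measure lebesgue E"
  shows "ennreal \<sigma> \<le> rearrangement_avg f t"
proof -
  let ?m = "measure lebesgue E"
  have "ennreal (\<sigma> * t) = ennreal (t / ?m) * ennreal (\<sigma> * ?m)"
    using t \<open>0 \<le> \<sigma>\<close> by (simp add: ennreal_mult[symmetric])
  also have "\<dots> \<le> ennreal (t / ?m) * truncated_mass f ?m"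
    using avg nn_integral_le_truncated_mass[OF f E] by (intro mult_left_mono) auto
  also have "\<dots> \<le> truncated_mass f t"
    by (rule truncated_mass_concave[OF f t])
  finally have "ennreal (\<sigma> * t) / ennreal t \<le> rearrangement_avg f t"
    unfolding rearrangement_avg_eq[OF f] by (rule divide_right_mono_ennreal)
  then show ?thesis
    using t \<open>0 \<le> \<sigma>\<close> by (simp add: divide_ennreal)
qed

text \<open>
  A sequence that at least doubles has partial sums of at most twice the last term, and the terms that are
  kept do not exceed \<open>F\<close>.
\<close>

lemma sum_doubling_le:
  fixes a :: "nat \<Rightarrow> real"
  assumes a: "\<And>k. 0 \<le> a k" "\<And>k. 2 * a k \<le> a (Suc k)" and "0 \<le> F"
  shows "(\<Sum>k<n. if a k \<le> F then a k else 0) \<le> 2 * F"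
proof -
  \<comment> \<open>The bound by the last term, and not only by \<open>F\<close>, is what makes the induction work.\<close>
  have "(\<Sum>k\<le>n. if a k \<le> F then a k else 0) \<le> 2 * min (a n) F"
  proof (induction n)
    case 0
    then show ?case using a(1)[of 0] \<open>0 \<le> F\<close> by (simp add: min_def)
  next
    case (Suc n)
    then show ?case using a(2)[of n] a(1)[of n] by (auto simp: min_def split: if_splits)
  qed
  moreover have "(\<Sum>k<n. if a k \<le> F then a k else 0) \<le> (\<Sum>k\<le>n. if a k \<le> F then a k else 0)"
    using a(1) by (intro sum_mono2) auto
  ultimately show ?thesis by auto
qed

text \<open>
  The integral is restricted to the upper half of \<open>(0, m)\<close> because a lower bound up to a constant is
  enough, and there the integrand is at least its value at \<open>m / 2\<close>.
\<close>

lemma powr_le_nn_integral_powr: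
  assumes "1 \<le> r" "0 \<le> m"
  shows "ennreal ((m / 2) powr r) \<le> (\<integral>\<^sup>+ t\<in>{m / 2<..<m}. ennreal (t powr (r - 1)) \<partial>lborel)"
proof (cases "m = 0")
  case False
  then have m: "0 < m" using assms by simp
  have "ennreal ((m / 2) powr r) = ennreal ((m / 2) powr (r - 1)) * ennreal (m / 2)"
    using m by (simp add: ennreal_mult[symmetric] powr_diff)
  also have "\<dots> = (\<integral>\<^sup>+ t\<in>{m / 2<..<m}. ennreal ((m / 2) powr (r - 1)) \<partial>lborel)"
    using m by (simp add: nn_integral_cmult_indicator)
  also have "\<dots> \<le> (\<integral>\<^sup>+ t\<in>{m / 2<..<m}. ennreal (t powr (r - 1)) \<partial>lborel)"
    using m assms(1) by (intro nn_integral_mono) (auto simp: indicator_def intro!: ennreal_leI powr_mono2)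
  finally show ?thesis .
qed simp

text \<open>
  At a point \<open>t\<close>, every \<open>k\<close> with \<open>t < \<bar>E\<^sub>k\<bar>\<close> satisfies \<open>2\<^sup>k s \<le> f\<^sup>*\<^sup>*(t)\<close>, so the \<open>q\<close>-th powers of these levels
  add up to at most \<open>2 f\<^sup>*\<^sup>*(t)\<^sup>q\<close>. Integrating against \<open>t\<^bsup>r - 1\<^esup>\<close>, \<open>r = q / p\<close>, turns each \<open>k\<close> into a multiple of
  \<open>\<bar>E\<^sub>k\<bar>\<^sup>r\<close>. The averaged rearrangement, in place of the rearrangement itself, is what allows averages of \<open>f\<close>
  over the sets \<open>E\<^sub>k\<close> here instead of pointwise bounds.
\<close>

lemma sum_levels_le_Lorentz_norm:
  assumes p: "1 < p" "p \<le> q" and "0 < s" and f: "f \<in> borel_measurable lebesgue"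
    and E: "\<And>k. E k \<in> lmeasurable"
    and avg: "\<And>k. ennreal (2 ^ k * s * measure lebesgue (E k)) \<le> (\<integral>\<^sup>+ x\<in>E k. ennreal \<bar>f x\<bar> \<partial>lebesgue)"
  shows "ennreal (\<Sum>k<n. (2 ^ k * s) powr q * measure lebesgue (E k) powr (q / p))
    \<le> ennreal (2 * 2 powr (q / p)) * ennpowr (Lorentz_norm p q f) q"
proof -
  define r where "r = q / p"
  define m where "m = (\<lambda>k. measure lebesgue (E k))"
  define a where "a = (\<lambda>k::nat. (2 ^ k * s) powr q)"
  have r: "1 \<le> r" and q: "0 < q" "1 \<le> q"
    using p by (auto simp: r_def)
  have m0: "0 \<le> m k" for k by (simp add: m_def)
  have a0: "0 \<le> a k" for k by (simp add: a_def)
  have a2: "2 * a k \<le> a (Suc k)" for k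
  proof -
    have "a (Suc k) = 2 powr q * a k"
      using \<open>0 < s\<close> by (simp add: a_def powr_mult[symmetric] mult.assoc)
    moreover have "(2::real) \<le> 2 powr q"
      using powr_mono[OF q(2), of 2] by simp
    ultimately show ?thesis using a0[of k] by (auto intro: mult_right_mono)
  qed
  have pointwise: "(\<Sum>k<n. ennreal (a k) * indicator {m k / 2<..<m k} t) \<le> 2 * ennpowr (rearrangement_avg f t) q"
    if "0 < t" for t
  proof (cases "rearrangement_avg f t")
    case (real F)
    have "(\<Sum>k<n. ennreal (a k) * indicator {m k / 2<..<m k} t)
        \<le> (\<Sum>k<n. ennreal (if a k \<le> F powr q then a k else 0))"
    proof (intro sum_mono)
      fix k
      have "a k \<le> F powr q" if "t \<in> {m k / 2<..<m k}"
      proof -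
        have "ennreal (2 ^ k * s) \<le> ennreal F"
          unfolding real(2)[symmetric]
          using that \<open>0 < t\<close> \<open>0 < s\<close> by (intro le_rearrangement_avg[OF f E _ avg]) (auto simp: m_def)
        then show ?thesis
          using real(1) \<open>0 < s\<close> q unfolding a_def by (intro powr_mono2) auto
      qed
      then show "ennreal (a k) * indicator {m k / 2<..<m k} t \<le> ennreal (if a k \<le> F powr q then a k else 0)"
        by (auto simp: indicator_def)
    qed
    also have "\<dots> = ennreal (\<Sum>k<n. if a k \<le> F powr q then a k else 0)"
      using a0 by (intro sum_ennreal) auto
    also have "\<dots> \<le> ennreal (2 * F powr q)"
      using a0 a2 by (intro ennreal_leI sum_doubling_le) auto
    also have "\<dots> = 2 * ennpowr (rearrangement_avg f t) q"
      using real by (simp add: ennpowr_ennreal ennreal_mult)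
    finally show ?thesis .
  next
    case top
    then show ?thesis by (simp add: ennpowr_def ennreal_mult_top)
  qed
  have half: "ennreal (a k * m k powr r) \<le> ennreal (2 powr r) * 
      (\<integral>\<^sup>+ t. ennreal (a k) * indicator {m k / 2<..<m k} t * ennreal (t powr (r - 1)) \<partial>lborel)" for k
  proof -
    have "a k * m k powr r = 2 powr r * (a k * (m k / 2) powr r)"
      using m0[of k] by (simp add: powr_divide)
    then have "ennreal (a k * m k powr r) = ennreal (2 powr r) * (ennreal (a k) * ennreal ((m k / 2) powr r))"
      using a0[of k] by (simp only: ennreal_mult powr_ge_zero mult_nonneg_nonneg)
    also have "\<dots> \<le> ennreal (2 powr r) * (ennreal (a k) * 
        (\<integral>\<^sup>+ t\<in>{m k / 2<..<m k}. ennreal (t powr (r - 1)) \<partial>lborel))"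
      by (intro mult_left_mono powr_le_nn_integral_powr r m0) auto
    also have "\<dots> = ennreal (2 powr r) * 
      (\<integral>\<^sup>+ t. ennreal (a k) * indicator {m k / 2<..<m k} t * ennreal (t powr (r - 1)) \<partial>lborel)"
      by (subst nn_integral_cmult[symmetric]) (auto simp: mult_ac)
    finally show ?thesis .
  qed
  have "ennreal (\<Sum>k<n. a k * m k powr r) = (\<Sum>k<n. ennreal (a k * m k powr r))"
    using a0 by (intro sum_ennreal[symmetric]) auto
  also have "\<dots> \<le> (\<Sum>k<n. ennreal (2 powr r) * 
      (\<integral>\<^sup>+ t. ennreal (a k) * indicator {m k / 2<..<m k} t * ennreal (t powr (r - 1)) \<partial>lborel))"
    by (intro sum_mono half)
  also have "\<dots> = ennreal (2 powr r) *
      (\<integral>\<^sup>+ t. (\<Sum>k<n. ennreal (a k) * indicator {m k / 2<..<m k} t) * ennreal (t powr (r - 1)) \<partial>lborel)"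
    unfolding sum_distrib_left[symmetric] sum_distrib_right
    by (subst nn_integral_sum) auto
  also have "\<dots> \<le> ennreal (2 powr r) *
      (\<integral>\<^sup>+ t. 2 * (ennpowr (rearrangement_avg f t) q * ennreal (t powr (r - 1)) * indicator {0<..} t) \<partial>lborel)"
  proof (intro mult_left_mono nn_integral_mono)
    fix t :: real
    show "(\<Sum>k<n. ennreal (a k) * indicator {m k / 2<..<m k} t) * ennreal (t powr (r - 1))
        \<le> 2 * (ennpowr (rearrangement_avg f t) q * ennreal (t powr (r - 1)) * indicator {0<..} t)"
    proof (cases "0 < t")
      case True
      then show ?thesis
        using mult_right_mono[OF pointwise[OF True], of "ennreal (t powr (r - 1))"] by (simp add: mult_ac)
    next
      case False
      have "indicator {m k / 2<..<m k} t = (0::ennreal)" for k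
        using False m0[of k] by (auto simp: indicator_def)
      then show ?thesis by simp
    qed
  qed simp
  also have "\<dots> \<le> ennreal (2 powr r) * (2 * ennpowr (Lorentz_norm p q f) q)"
    unfolding Lorentz_norm_powr[OF q(1)] r_def[symmetric]
    using f by (subst nn_integral_cmult) auto
  finally show ?thesis
    by (simp add: m_def a_def r_def ennreal_mult mult_ac)
qed

section \<open>Dyadic cells of a cube\<close>

text \<open>
  The half-open dyadic cube of generation \<open>m\<close> that contains \<open>x\<close>, in the grid with origin \<open>a\<close> and side \<open>l\<close>.
  Defining it as a class of points with equal integer parts makes cells of one generation disjoint and
  cells of successive generations nested without any case distinction.
\<close>

definition dyadic_cell :: "real ^ 'n \<Rightarrow> real \<Rightarrow> nat \<Rightarrow> real ^ 'n \<Rightarrow> (real ^ 'n) set" where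
  "dyadic_cell a l m x = {y. \<forall>i. \<lfloor>(y $ i - a $ i) * 2 ^ m / l\<rfloor> = \<lfloor>(x $ i - a $ i) * 2 ^ m / l\<rfloor>}"

lemma self_in_dyadic_cell [simp]: "x \<in> dyadic_cell a l m x"
  by (simp add: dyadic_cell_def)

lemma dyadic_cell_eq: "y \<in> dyadic_cell a l m x \<Longrightarrow> dyadic_cell a l m y = dyadic_cell a l m x"
  by (simp add: dyadic_cell_def)

lemma dyadic_cell_Suc_subset: "dyadic_cell a l (Suc m) x \<subseteq> dyadic_cell a l m x"
proof -
  have "\<lfloor>z * 2 ^ m / l\<rfloor> = \<lfloor>z * 2 ^ Suc m / l\<rfloor> div 2" for z
    using floor_divide_real_eq_div[of 2 "z * 2 ^ Suc m / l"] by simp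
  then show ?thesis
    unfolding dyadic_cell_def by (auto simp only: subset_eq mem_Collect_eq)
qed

lemma dyadic_cell_antimono: "m \<le> m' \<Longrightarrow> dyadic_cell a l m' x \<subseteq> dyadic_cell a l m x"
  by (induction m' rule: dec_induct) (use dyadic_cell_Suc_subset in blast)+

text \<open>
  The point \<open>b\<close> is the lower corner of the cell, obtained by rounding the coordinates of \<open>x\<close> down to the grid.
\<close>

lemma dyadic_cell_between:
  fixes a :: "real ^ 'n"
  assumes "0 < l"
  obtains b where "box b (\<chi> i. b $ i + l / 2 ^ m) \<subseteq> dyadic_cell a l m x"
    "dyadic_cell a l m x \<subseteq> cbox b (\<chi> i. b $ i + l / 2 ^ m)"
    "\<And>y i. y \<in> dyadic_cell a l m x \<Longrightarrow> b $ i \<le> y $ i \<and> y $ i < b $ i + l / 2 ^ m"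
proof
  define b :: "real ^ 'n" where "b = (\<chi> i. a $ i + of_int \<lfloor>(x $ i - a $ i) * 2 ^ m / l\<rfloor> * (l / 2 ^ m))"
  have h: "0 < l / 2 ^ m"
    using assms by simp
  have *: "\<lfloor>(y $ i - a $ i) * 2 ^ m / l\<rfloor> = \<lfloor>(x $ i - a $ i) * 2 ^ m / l\<rfloor> \<longleftrightarrow>
      b $ i \<le> y $ i \<and> y $ i < b $ i + l / 2 ^ m" for y i
  proof -
    have "(y $ i - a $ i) * 2 ^ m / l = (y $ i - a $ i) / (l / 2 ^ m)"
      by simp
    then show ?thesis
      unfolding b_def floor_eq_iff
      by (simp only: vec_lambda_beta pos_le_divide_eq[OF h] pos_divide_less_eq[OF h] distrib_right) linarith
  qed
  show "box b (\<chi> i. b $ i + l / 2 ^ m) \<subseteq> dyadic_cell a l m x"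
    "dyadic_cell a l m x \<subseteq> cbox b (\<chi> i. b $ i + l / 2 ^ m)"
    unfolding dyadic_cell_def * by (auto simp: mem_box_cart less_imp_le)
  show "b $ i \<le> y $ i \<and> y $ i < b $ i + l / 2 ^ m" if "y \<in> dyadic_cell a l m x" for y i
    using that unfolding dyadic_cell_def * by auto
qed

lemma measure_cube:
  fixes b :: "real ^ 'n"
  assumes "0 < h"
  shows "measure lebesgue (cbox b (\<chi> i. b $ i + h)) = h ^ CARD('n)"
  proof -
  have "b \<in> cbox b (\<chi> i. b $ i + h)"
    using assms by (simp add: mem_box_cart)
  then have "measure lborel (cbox b (\<chi> i. b $ i + h)) = h ^ CARD('n)"
    by (subst content_cbox_cart) auto
  then show ?thesis by simp
qed

lemma dyadic_cell_cube:
  fixes a :: "real ^ 'n"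
  assumes "0 < l"
  obtains Q where "Q \<in> cubes" "dyadic_cell a l m x \<subseteq> Q" "negligible (Q - dyadic_cell a l m x)"
    "measure lebesgue Q = (l / 2 ^ m) ^ CARD('n)"
proof -
  have h: "0 < l / 2 ^ m"
    using assms by simp
  obtain b where b: "box b (\<chi> i. b $ i + l / 2 ^ m) \<subseteq> dyadic_cell a l m x"
    "dyadic_cell a l m x \<subseteq> cbox b (\<chi> i. b $ i + l / 2 ^ m)"
    using dyadic_cell_between[OF assms] by metis
  show thesis
  proof
    show "cbox b (\<chi> i. b $ i + l / 2 ^ m) \<in> cubes"
      using h by (auto simp: cubes_def)
    show "negligible (cbox b (\<chi> i. b $ i + l / 2 ^ m) - dyadic_cell a l m x)"
      using b(1) by (intro negligible_subset[OF negligible_frontier_interval]) auto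
  qed (use b measure_cube[OF h] in auto)
qed

lemma cubes_lmeasurable: "Q \<in> cubes \<Longrightarrow> Q \<in> lmeasurable"
  by (auto simp: cubes_def)

lemma dyadic_cell_lmeasurable:
  fixes a :: "real ^ 'n"
  assumes "0 < l"
  shows "dyadic_cell a l m x \<in> lmeasurable"
    and "measure lebesgue (dyadic_cell a l m x) = (l / 2 ^ m) ^ CARD('n)"
proof -
  obtain Q where Q: "Q \<in> cubes" "dyadic_cell a l m x \<subseteq> Q" "negligible (Q - dyadic_cell a l m x)"
    "measure lebesgue Q = (l / 2 ^ m) ^ CARD('n)"
    using dyadic_cell_cube[OF assms] by metis
  have eq: "dyadic_cell a l m x = Q - (Q - dyadic_cell a l m x)"
    using Q(2) by auto
  show "dyadic_cell a l m x \<in> lmeasurable"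
    by (subst eq) (intro fmeasurable_Diff cubes_lmeasurable Q(1) negligible_imp_sets Q(3))
  show "measure lebesgue (dyadic_cell a l m x) = (l / 2 ^ m) ^ CARD('n)"
    by (subst eq) (use Q in \<open>simp add: measure_Diff_null_set negligible_iff_null_sets cubes_lmeasurable fmeasurableD\<close>)
qed

lemma dyadic_cell_in_open:
  fixes a :: "real ^ 'n"
  assumes "0 < l" "open U" "x \<in> U"
  obtains M where "dyadic_cell a l M x \<subseteq> U"
proof -
  obtain e where e: "0 < e" "ball x e \<subseteq> U"
    using assms(2,3) openE by blast
  obtain M where "CARD('n) * l / e < 2 ^ M"
    using real_arch_pow[of 2 "CARD('n) * l / e"] by auto
  then have M: "CARD('n) * (l / 2 ^ M) < e"
    using e assms(1) by (simp add: field_simps)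
  obtain b where b: "\<And>y i. y \<in> dyadic_cell a l M x \<Longrightarrow> b $ i \<le> y $ i \<and> y $ i < b $ i + l / 2 ^ M"
    using dyadic_cell_between[OF assms(1)] by metis
  have "y \<in> ball x e" if y: "y \<in> dyadic_cell a l M x" for y
  proof -
    have close: "\<bar>(y - x) $ i\<bar> \<le> l / 2 ^ M" for i
      using b[OF y, of i] b[OF self_in_dyadic_cell, of i] unfolding vector_minus_component by linarith
    have "norm (y - x) \<le> (\<Sum>i\<in>UNIV. \<bar>(y - x) $ i\<bar>)"
      by (rule norm_le_l1_cart)
    also have "\<dots> \<le> (\<Sum>i\<in>(UNIV::'n set). l / 2 ^ M)"
      using close by (intro sum_mono) auto
    also have "\<dots> < e"
      using M by simp
    finally show ?thesis
      by (simp add: dist_norm norm_minus_commute)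
  qed
  then show thesis
    using that e(2) by blast
qed

text \<open>
  A cell of generation \<open>m\<close> in the root is determined by \<open>n\<close> integers between \<open>0\<close> and \<open>2\<^sup>m - 1\<close>.
\<close>

lemma finite_dyadic_cells:
  fixes a :: "real ^ 'n"
  assumes "0 < l"
  shows "finite (dyadic_cell a l m ` dyadic_cell a l 0 a)"
proof -
  define c where "c = (\<lambda>k::'n \<Rightarrow> int. {y. \<forall>i. \<lfloor>(y $ i - a $ i) * 2 ^ m / l\<rfloor> = k i})"
  have "dyadic_cell a l m x \<in> c ` PiE UNIV (\<lambda>_. {0..<2 ^ m})" if x: "x \<in> dyadic_cell a l 0 a" for x
  proof -
    define k where "k = (\<lambda>i. \<lfloor>(x $ i - a $ i) * 2 ^ m / l\<rfloor>)"
    have "0 \<le> k i \<and> k i < 2 ^ m" for i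
    proof -
      have "0 \<le> (x $ i - a $ i) / l" "(x $ i - a $ i) / l < 1"
        using x by (simp_all add: dyadic_cell_def floor_eq_iff)
      then have "0 \<le> (x $ i - a $ i) / l * 2 ^ m" "(x $ i - a $ i) / l * 2 ^ m < 1 * 2 ^ m"
        by (intro mult_nonneg_nonneg mult_strict_right_mono; simp)+
      then show ?thesis
        by (simp add: k_def le_floor_iff floor_less_iff)
    qed
    moreover have "dyadic_cell a l m x = c k"
      by (simp add: dyadic_cell_def c_def k_def)
    ultimately show ?thesis by auto
  qed
  then have "dyadic_cell a l m ` dyadic_cell a l 0 a \<subseteq> c ` PiE UNIV (\<lambda>_. {0..<2 ^ m})"
    by blast
  moreover have "finite (c ` PiE UNIV (\<lambda>_. {0..<2 ^ m}))"
    by (intro finite_imageI finite_PiE) simp_all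
  ultimately show ?thesis
    by (rule finite_subset)
qed

text \<open>
  Closed cubes are handled through half-open cells, from which they differ by part of the boundary.
\<close>

lemma cube_eq_dyadic_root:
  fixes Q :: "(real ^ 'n) set"
  assumes "Q \<in> cubes"
  obtains a l where "0 < l" "dyadic_cell a l 0 a \<subseteq> Q" "negligible (Q - dyadic_cell a l 0 a)"
proof -
  obtain a l where Q: "Q = cbox a (\<chi> i. a $ i + l)" "0 < l"
    using assms by (auto simp: cubes_def)
  have *: "\<lfloor>(y $ i - a $ i) * 2 ^ 0 / l\<rfloor> = \<lfloor>(a $ i - a $ i) * 2 ^ 0 / l\<rfloor> \<longleftrightarrow> a $ i \<le> y $ i \<and> y $ i < a $ i + l" for y i
    using Q(2) by (simp add: floor_eq_iff field_simps)
  show thesis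
  proof (rule that[OF Q(2)])
    show "dyadic_cell a l 0 a \<subseteq> Q"
      unfolding dyadic_cell_def * Q(1) by (auto simp: mem_box_cart less_imp_le)
    have "box a (\<chi> i. a $ i + l) \<subseteq> dyadic_cell a l 0 a"
      unfolding dyadic_cell_def * by (auto simp: mem_box_cart less_imp_le)
    then show "negligible (Q - dyadic_cell a l 0 a)"
      unfolding Q(1) by (intro negligible_subset[OF negligible_frontier_interval]) auto
  qed
qed

lemma cubes_measure_pos: "Q \<in> cubes \<Longrightarrow> 0 < measure lebesgue Q"
  by (auto simp: cubes_def measure_cube simp del: measure_completion)

lemma negligible_Diff_measure:
  assumes "R \<in> lmeasurable" "R \<subseteq> Q" "negligible (Q - R)"
  shows "measure lebesgue Q = measure lebesgue R"
proof -
  have "Q = R \<union> (Q - R)" using assms(2) by blast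
  then show ?thesis
    using assms by (metis measure_Un_null_set negligible_iff_null_sets fmeasurableD)
qed

lemma AE_indicator_negligible_Diff:
  assumes "R \<subseteq> Q" "negligible (Q - R)"
  shows "AE x in lebesgue. indicator Q x = (indicator R x :: 'b::zero_neq_one)"
proof -
  have "AE x in lebesgue. x \<notin> Q - R"
    using assms(2) by (intro AE_not_in) (simp add: negligible_iff_null_sets)
  then show ?thesis
    by eventually_elim (use assms(1) in \<open>auto simp: indicator_def\<close>)
qed

lemma negligible_Diff_set_integral:
  fixes w :: "'a::euclidean_space \<Rightarrow> real"
  assumes "set_integrable lebesgue Q w" "R \<in> sets lebesgue" "R \<subseteq> Q" "negligible (Q - R)"
  shows "(LINT x:Q|lebesgue. w x) = (LINT x:R|lebesgue. w x)"
  unfolding set_lebesgue_integral_def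
proof (rule integral_cong_AE)
  show "(\<lambda>x. indicat_real Q x *\<^sub>R w x) \<in> borel_measurable lebesgue"
    using assms(1) by (auto simp: set_integrable_def)
  show "(\<lambda>x. indicat_real R x *\<^sub>R w x) \<in> borel_measurable lebesgue"
    using set_integrable_subset[OF assms(1-3)] by (auto simp: set_integrable_def)
  show "AE x in lebesgue. indicat_real Q x *\<^sub>R w x = indicat_real R x *\<^sub>R w x"
    using AE_indicator_negligible_Diff[OF assms(3,4), where 'b=real] by eventually_elim simp
qed

section \<open>Stopping cells of a weight\<close>

text \<open>
  The setting of a Calderon--Zygmund decomposition of the root cell. Nonnegativity is what allows a cell to
  be compared with its parent.
\<close>

locale dyadic_stopping =
  fixes a :: "real ^ 'n" and l :: real and w :: "real ^ 'n \<Rightarrow> real"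
  assumes l: "0 < l"
    and integrable: "set_integrable lebesgue (dyadic_cell a l 0 a) w"
    and nonneg: "AE x in lebesgue. 0 \<le> w x"
begin

abbreviation cell :: "nat \<Rightarrow> real ^ 'n \<Rightarrow> (real ^ 'n) set" where
  "cell \<equiv> dyadic_cell a l"

abbreviation root :: "(real ^ 'n) set" where
  "root \<equiv> cell 0 a"

abbreviation mass :: "(real ^ 'n) set \<Rightarrow> real" where
  "mass E \<equiv> LINT x:E|lebesgue. w x"

definition heavy :: "real \<Rightarrow> (real ^ 'n) set \<Rightarrow> bool" where
  "heavy \<sigma> R \<longleftrightarrow> \<sigma> * measure lebesgue R < mass R"

text \<open>
  The set where the dyadic maximal function, restricted to generations up to \<open>M\<close>, exceeds \<open>\<sigma>\<close>.
\<close>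

definition maximal_level :: "real \<Rightarrow> nat \<Rightarrow> (real ^ 'n) set" where
  "maximal_level \<sigma> M = {x \<in> root. \<exists>m\<le>M. heavy \<sigma> (cell m x)}"

text \<open>
  The maximal heavy cells, namely those reached by the first generation that is heavy at a point.
\<close>

definition stopping_cells :: "real \<Rightarrow> nat \<Rightarrow> (real ^ 'n) set set" where
  "stopping_cells \<sigma> M =
    {cell m x | m x. x \<in> root \<and> m \<le> M \<and> heavy \<sigma> (cell m x) \<and> (\<forall>m'<m. \<not> heavy \<sigma> (cell m' x))}"

lemma cell_subset_root: "x \<in> root \<Longrightarrow> cell m x \<subseteq> root"
  using dyadic_cell_antimono[of 0 m a l x] dyadic_cell_eq[of x a l 0 a] by simp

lemma integrable_subset: "E \<in> sets lebesgue \<Longrightarrow> E \<subseteq> root \<Longrightarrow> set_integrable lebesgue E w"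
  using integrable by (rule set_integrable_subset)

lemma mass_mono:
  assumes "E \<in> sets lebesgue" "F \<in> sets lebesgue" "E \<subseteq> F" "F \<subseteq> root"
  shows "mass E \<le> mass F"
  unfolding set_lebesgue_integral_def
proof (rule integral_mono_AE)
  show "integrable lebesgue (\<lambda>x. indicat_real E x *\<^sub>R w x)" "integrable lebesgue (\<lambda>x. indicat_real F x *\<^sub>R w x)"
    using integrable_subset[of E] integrable_subset[of F] assms by (auto simp: set_integrable_def)
  show "AE x in lebesgue. indicat_real E x *\<^sub>R w x \<le> indicat_real F x *\<^sub>R w x"
    using nonneg by eventually_elim (use assms(3) in \<open>auto simp: indicator_def\<close>)
qed

lemma heavy_antimono: "s \<le> \<sigma> \<Longrightarrow> heavy \<sigma> R \<Longrightarrow> heavy s R"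
  unfolding heavy_def by (smt (verit) measure_nonneg mult_right_mono)

lemma maximal_level_antimono: "s \<le> \<sigma> \<Longrightarrow> maximal_level \<sigma> M \<subseteq> maximal_level s M"
  unfolding maximal_level_def using heavy_antimono by blast

lemma maximal_level_mono: "M \<le> M' \<Longrightarrow> maximal_level \<sigma> M \<subseteq> maximal_level \<sigma> M'"
  unfolding maximal_level_def using order_trans by blast

text \<open>
  A stopping cell is the stopping cell of each of its points, because all coarser cells through its points
  agree as well.
\<close>

lemma stopping_cellsE:
  assumes "R \<in> stopping_cells \<sigma> M" "z \<in> R"
  obtains m where "R = cell m z" "z \<in> root" "m \<le> M" "heavy \<sigma> R" "\<And>m'. m' < m \<Longrightarrow> \<not> heavy \<sigma> (cell m' z)"
proof -
  obtain m x where *: "R = cell m x" "x \<in> root" "m \<le> M" "heavy \<sigma> (cell m x)" "\<forall>m'<m. \<not> heavy \<sigma> (cell m' x)"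
    using assms(1) unfolding stopping_cells_def by blast
  have "z \<in> cell m' x" if "m' \<le> m" for m'
    using assms(2) dyadic_cell_antimono[OF that] * by blast
  then have eq: "cell m' z = cell m' x" if "m' \<le> m" for m'
    using that by (intro dyadic_cell_eq) auto
  show thesis
    using that[of m] * eq assms(2) cell_subset_root[of x m] by (auto simp: less_imp_le)
qed

lemma stopping_cells_lmeasurable: "R \<in> stopping_cells \<sigma> M \<Longrightarrow> R \<in> lmeasurable"
  unfolding stopping_cells_def using dyadic_cell_lmeasurable(1)[OF l] by blast

lemma stopping_cells_subset_root: "R \<in> stopping_cells \<sigma> M \<Longrightarrow> R \<subseteq> root"
  unfolding stopping_cells_def using cell_subset_root by blast

lemma stopping_cells_pos: "R \<in> stopping_cells \<sigma> M \<Longrightarrow> 0 < measure lebesgue R"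
  unfolding stopping_cells_def using dyadic_cell_lmeasurable(2)[OF l, of a] l by auto

lemma finite_stopping_cells: "finite (stopping_cells \<sigma> M)"
proof (rule finite_subset)
  show "stopping_cells \<sigma> M \<subseteq> (\<Union>m\<le>M. cell m ` root)"
    unfolding stopping_cells_def by blast
  show "finite (\<Union>m\<le>M. cell m ` root)"
    using finite_dyadic_cells[OF l] by blast
qed

lemma Union_stopping_cells: "\<Union>(stopping_cells \<sigma> M) = maximal_level \<sigma> M"
proof (intro equalityI subsetI)
  fix x assume "x \<in> \<Union>(stopping_cells \<sigma> M)"
  then obtain R where "R \<in> stopping_cells \<sigma> M" "x \<in> R"
    by blast
  then show "x \<in> maximal_level \<sigma> M"
    by (elim stopping_cellsE) (auto simp: maximal_level_def)
next
  fix x assume "x \<in> maximal_level \<sigma> M"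
  then obtain m where m: "x \<in> root" "m \<le> M" "heavy \<sigma> (cell m x)"
    by (auto simp: maximal_level_def)
  define m0 where "m0 = (LEAST m. heavy \<sigma> (cell m x))"
  have "heavy \<sigma> (cell m0 x)" "m0 \<le> m" "\<forall>m'<m0. \<not> heavy \<sigma> (cell m' x)"
    using m(3) unfolding m0_def by (auto intro: LeastI Least_le dest: not_less_Least)
  then have "cell m0 x \<in> stopping_cells \<sigma> M"
    using m unfolding stopping_cells_def by (auto intro: order_trans)
  then show "x \<in> \<Union>(stopping_cells \<sigma> M)"
    using self_in_dyadic_cell by blast
qed

text \<open>
  A cell that is heavy at a level is heavy at every lower level, so stopping comes earlier there.
\<close>

lemma stopping_cells_nested:
  assumes "s \<le> \<sigma>" "R \<in> stopping_cells s M" "R' \<in> stopping_cells \<sigma> M" "R \<inter> R' \<noteq> {}"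
  shows "R' \<subseteq> R"
proof -
  obtain z where z: "z \<in> R" "z \<in> R'"
    using assms(4) by blast
  obtain m where m: "R = cell m z" "\<And>m'. m' < m \<Longrightarrow> \<not> heavy s (cell m' z)"
    using assms(2) z(1) by (rule stopping_cellsE) blast
  obtain m' where m': "R' = cell m' z" "heavy \<sigma> R'"
    using assms(3) z(2) by (rule stopping_cellsE) blast
  have "m \<le> m'"
    using m(2) m' heavy_antimono[OF assms(1)] by (meson not_less)
  then show ?thesis
    unfolding m m' by (rule dyadic_cell_antimono)
qed

lemma maximal_level_lmeasurable: "maximal_level \<sigma> M \<in> lmeasurable"
  unfolding Union_stopping_cells[symmetric]
  using finite_stopping_cells stopping_cells_lmeasurable by (intro fmeasurable.finite_Union) auto

lemma maximal_level_subset_root: "maximal_level \<sigma> M \<subseteq> root"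
  by (auto simp: maximal_level_def)

text \<open>
  The root is not heavy, so a stopping cell has a parent, and the parent is not heavy either; it has \<open>2\<^sup>n\<close>
  times the measure of the cell.
\<close>

lemma mass_cell_le:
  assumes "\<not> heavy \<sigma> root" "R \<in> stopping_cells \<sigma> M"
  shows "mass R \<le> 2 ^ CARD('n) * \<sigma> * measure lebesgue R"
proof -
  obtain m x where *: "R = cell m x" "x \<in> root" "heavy \<sigma> (cell m x)" "\<forall>m'<m. \<not> heavy \<sigma> (cell m' x)"
    using assms(2) unfolding stopping_cells_def by blast
  have "cell 0 x = root"
    by (rule dyadic_cell_eq) fact
  then have "m \<noteq> 0"
    using assms(1) * by (metis)
  then obtain k where k: "m = Suc k"
    by (cases m) auto
  have "mass R \<le> mass (cell k x)"
    unfolding * k using cell_subset_root[OF *(2)] dyadic_cell_lmeasurable(1)[OF l]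
    by (intro mass_mono dyadic_cell_Suc_subset) blast+
  also have "\<dots> \<le> \<sigma> * measure lebesgue (cell k x)"
    using *(4) k by (auto simp: heavy_def)
  also have "measure lebesgue (cell k x) = 2 ^ CARD('n) * measure lebesgue R"
    unfolding * k dyadic_cell_lmeasurable(2)[OF l] by (simp add: power_mult_distrib[symmetric])
  finally show ?thesis
    by (simp add: mult_ac)
qed

lemma disjoint_family_cells: "disjoint_family_on (\<lambda>R. E \<inter> R) (cell M ` X)"
  unfolding disjoint_family_on_def using dyadic_cell_eq by blast

lemma disjoint_family_stopping_cells: "disjoint_family_on (\<lambda>R. E \<inter> R) (stopping_cells \<sigma> M)"
  unfolding disjoint_family_on_def using stopping_cells_nested[OF order_refl] by blast

lemma measure_sum_disjoint:
  assumes "finite I" "disjoint_family_on (\<lambda>R. E \<inter> R) I" "E \<in> sets lebesgue" "E \<subseteq> \<Union>I"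
    "\<And>R. R \<in> I \<Longrightarrow> R \<in> lmeasurable"
  shows "measure lebesgue E = (\<Sum>R\<in>I. measure lebesgue (E \<inter> R))"
proof -
  have "E = (\<Union>R\<in>I. E \<inter> R)"
    using assms(4) by blast
  then have "measure lebesgue E = measure lebesgue (\<Union>R\<in>I. E \<inter> R)"
    by simp
  also have "\<dots> = (\<Sum>R\<in>I. measure lebesgue (E \<inter> R))"
  proof (rule measure_UNION')
    show "E \<inter> R \<in> lmeasurable" if "R \<in> I" for R
      using assms(3) assms(5)[OF that] by (metis fmeasurable_Int_fmeasurable inf_commute)
    show "pairwise (\<lambda>R R'. disjnt (E \<inter> R) (E \<inter> R')) I"
      using assms(2) by (auto simp: pairwise_def disjnt_def disjoint_family_on_def)
  qed fact
  finally show ?thesis .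
qed

lemma mass_sum_disjoint:
  assumes "finite I" "disjoint_family_on (\<lambda>R. E \<inter> R) I" "E \<in> sets lebesgue" "E \<subseteq> \<Union>I" "E \<subseteq> root"
    "\<And>R. R \<in> I \<Longrightarrow> R \<in> lmeasurable"
  shows "mass E = (\<Sum>R\<in>I. mass (E \<inter> R))"
proof -
  have "E = (\<Union>R\<in>I. E \<inter> R)"
    using assms(4) by blast
  then have "mass E = mass (\<Union>R\<in>I. E \<inter> R)"
    by simp
  also have "\<dots> = (\<Sum>R\<in>I. mass (E \<inter> R))"
  proof (rule set_integral_finite_Union)
    show "E \<inter> R \<in> sets lebesgue" if "R \<in> I" for R
      using assms(3) assms(6)[OF that] by auto
    then show "set_integrable lebesgue (E \<inter> R) w" if "R \<in> I" for R
      using that assms(5) by (intro integrable_subset) auto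
  qed fact+
  finally show ?thesis .
qed

lemma measure_maximal_level:
  "measure lebesgue (maximal_level \<sigma> M) = (\<Sum>R\<in>stopping_cells \<sigma> M. measure lebesgue R)"
proof -
  have "measure lebesgue (maximal_level \<sigma> M) =
      (\<Sum>R\<in>stopping_cells \<sigma> M. measure lebesgue (maximal_level \<sigma> M \<inter> R))"
    using maximal_level_lmeasurable stopping_cells_lmeasurable
    by (intro measure_sum_disjoint finite_stopping_cells disjoint_family_stopping_cells)
      (auto simp: Union_stopping_cells)
  also have "\<dots> = (\<Sum>R\<in>stopping_cells \<sigma> M. measure lebesgue R)"
    using Union_stopping_cells[of \<sigma> M] by (intro sum.cong refl arg_cong[where f="measure lebesgue"]) blast
  finally show ?thesis .
qed

text \<open>
  By nesting, the part of the higher level set inside \<open>R\<close> is a disjoint union of whole stopping cells of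
  the level \<open>\<sigma>\<close>, and each of these is heavy.
\<close>

lemma mass_maximal_level_Int_ge:
  assumes "s \<le> \<sigma>" "R \<in> stopping_cells s M"
  shows "\<sigma> * measure lebesgue (maximal_level \<sigma> M \<inter> R) \<le> mass (maximal_level \<sigma> M \<inter> R)"
proof -
  let ?E = "maximal_level \<sigma> M \<inter> R"
  have E: "?E \<in> sets lebesgue" "?E \<subseteq> \<Union>(stopping_cells \<sigma> M)" "?E \<subseteq> root"
    using maximal_level_lmeasurable stopping_cells_lmeasurable[OF assms(2)]
      stopping_cells_subset_root[OF assms(2)] by (auto simp: Union_stopping_cells)
  have "\<sigma> * measure lebesgue (?E \<inter> R') \<le> mass (?E \<inter> R')" if R': "R' \<in> stopping_cells \<sigma> M" for R'
  proof (cases "R \<inter> R' = {}")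
    case True
    then have "?E \<inter> R' = {}" by blast
    then show ?thesis by (simp add: set_lebesgue_integral_def)
  next
    case False
    then have "?E \<inter> R' = R'"
      using stopping_cells_nested[OF assms R'] R' Union_stopping_cells[of \<sigma> M] by blast
    moreover have "heavy \<sigma> R'"
      using R' by (auto simp: stopping_cells_def)
    ultimately show ?thesis
      by (simp add: heavy_def)
  qed
  then have *: "\<sigma> * (\<Sum>R'\<in>stopping_cells \<sigma> M. measure lebesgue (?E \<inter> R')) \<le>
      (\<Sum>R'\<in>stopping_cells \<sigma> M. mass (?E \<inter> R'))"
    unfolding sum_distrib_left by (rule sum_mono)
  have "(\<Sum>R'\<in>stopping_cells \<sigma> M. measure lebesgue (?E \<inter> R')) = measure lebesgue ?E"
    using E by (intro measure_sum_disjoint[symmetric] finite_stopping_cells disjoint_family_stopping_cells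
      stopping_cells_lmeasurable)
  moreover have "(\<Sum>R'\<in>stopping_cells \<sigma> M. mass (?E \<inter> R')) = mass ?E"
    using E by (intro mass_sum_disjoint[symmetric] finite_stopping_cells disjoint_family_stopping_cells
      stopping_cells_lmeasurable)
  ultimately show ?thesis
    using * by (simp only:)
qed

text \<open>
  This replaces the differentiation theorem. Cover \<open>E\<close> by an open set \<open>U\<close> of almost the same measure. The
  points whose cell of generation \<open>M\<close> stays inside \<open>U\<close> are covered by finitely many disjoint cells in \<open>U\<close>,
  none of them heavy, and these points exhaust \<open>E\<close> as \<open>M\<close> grows.
\<close>

lemma mass_le_of_not_heavy:
  assumes "0 \<le> \<sigma>" and E: "E \<in> sets lebesgue" "E \<subseteq> root"
    and light: "\<And>x m. x \<in> E \<Longrightarrow> \<not> heavy \<sigma> (cell m x)"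
  shows "mass E \<le> \<sigma> * measure lebesgue E"
proof (rule field_le_epsilon)
  fix \<epsilon> :: real assume "0 < \<epsilon>"
  define e where "e = \<epsilon> / (\<sigma> + 1)"
  have e: "0 < e" "\<sigma> * e \<le> \<epsilon>"
    using \<open>0 < \<epsilon>\<close> \<open>0 \<le> \<sigma>\<close> by (auto simp: e_def field_simps)
  obtain U where U: "open U" "E \<subseteq> U" "U - E \<in> lmeasurable" "emeasure lebesgue (U - E) < ennreal e"
    using sets_lebesgue_outer_open[OF E(1) e(1)] by blast
  have E_fin: "E \<in> lmeasurable"
    using E dyadic_cell_lmeasurable(1)[OF l] by (metis fmeasurableI2)
  have U_eq: "U = E \<union> (U - E)"
    using U(2) by blast
  have U_fin: "U \<in> lmeasurable"
    by (subst U_eq) (intro fmeasurable.Un E_fin U(3))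
  have "measure lebesgue U \<le> measure lebesgue E + measure lebesgue (U - E)"
    by (subst U_eq) (intro measure_Un_le fmeasurableD E_fin U(3))
  moreover have "measure lebesgue (U - E) < e"
    using U(3,4) e(1) by (simp add: emeasure_eq_measure2 ennreal_less_iff)
  ultimately have U_meas: "measure lebesgue U \<le> measure lebesgue E + e"
    by simp
  define A where "A = (\<lambda>M. {x \<in> E. cell M x \<subseteq> U})"
  define W where "W = (\<lambda>M. \<Union>(cell M ` A M))"
  have fin: "finite (cell M ` A M)" for M
    using E(2) by (intro finite_subset[OF image_mono finite_dyadic_cells[OF l]]) (auto simp: A_def)
  have W_fin: "W M \<in> lmeasurable" for M
    unfolding W_def using fin dyadic_cell_lmeasurable(1)[OF l] by (intro fmeasurable.finite_Union) auto
  have W_sub: "W M \<subseteq> U" "W M \<subseteq> root" for M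
    using cell_subset_root E(2) unfolding W_def A_def by blast+
  have A_eq: "A M = E \<inter> W M" for M
  proof (intro equalityI subsetI)
    fix y assume "y \<in> E \<inter> W M"
    then obtain x where x: "x \<in> A M" "y \<in> cell M x" "y \<in> E"
      by (auto simp: W_def)
    show "y \<in> A M"
      using x dyadic_cell_eq[OF x(2)] by (simp add: A_def)
  qed (auto simp: W_def A_def)
  have A_sets: "A M \<in> sets lebesgue" for M
    unfolding A_eq using E(1) W_fin[of M] by auto
  have bound: "mass (A M) \<le> \<sigma> * measure lebesgue E + \<epsilon>" for M
  proof -
    have W_cells: "W M \<inter> R = R" if "R \<in> cell M ` A M" for R
      using that by (auto simp: W_def)
    have "mass (A M) \<le> mass (W M)"
      using A_sets W_fin[of M] W_sub A_eq by (intro mass_mono) auto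
    also have "\<dots> = (\<Sum>R\<in>cell M ` A M. mass (W M \<inter> R))"
      using fin W_fin[of M] W_sub disjoint_family_cells dyadic_cell_lmeasurable(1)[OF l]
      by (intro mass_sum_disjoint) (auto simp: W_def)
    also have "\<dots> \<le> (\<Sum>R\<in>cell M ` A M. \<sigma> * measure lebesgue (W M \<inter> R))"
    proof (rule sum_mono)
      fix R assume R: "R \<in> cell M ` A M"
      then have "\<not> heavy \<sigma> R"
        using light by (auto simp: A_def)
      then show "mass (W M \<inter> R) \<le> \<sigma> * measure lebesgue (W M \<inter> R)"
        unfolding W_cells[OF R] heavy_def by simp
    qed
    also have "\<dots> = \<sigma> * measure lebesgue (W M)"
      unfolding sum_distrib_left[symmetric]
      using fin W_fin[of M] disjoint_family_cells dyadic_cell_lmeasurable(1)[OF l]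
      by (subst (2) measure_sum_disjoint[of "cell M ` A M"]) (auto simp: W_def)
    also have "\<dots> \<le> \<sigma> * (measure lebesgue E + e)"
      using U_meas measure_mono_fmeasurable[OF W_sub(1) _ U_fin] W_fin \<open>0 \<le> \<sigma>\<close>
      by (intro mult_left_mono) (meson fmeasurableD order_trans)+
    finally show ?thesis
      using e(2) by (simp add: distrib_left)
  qed
  have "incseq A"
  proof (rule incseq_SucI)
    show "A M \<subseteq> A (Suc M)" for M
      unfolding A_def using dyadic_cell_Suc_subset by blast
  qed
  moreover have UN_A: "(\<Union>M. A M) = E"
  proof -
    have "\<exists>M. x \<in> A M" if "x \<in> E" for x
      using dyadic_cell_in_open[OF l U(1), of x] that U(2) unfolding A_def by blast
    then show ?thesis
      by (auto simp: A_def)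
  qed
  ultimately have "(\<lambda>M. mass (A M)) \<longlonglongrightarrow> mass E"
    using set_integral_cont_up[of A lebesgue w] A_sets integrable_subset[OF E] by simp
  then show "mass E \<le> \<sigma> * measure lebesgue E + \<epsilon>"
    by (rule LIMSEQ_le_const2) (use bound in auto)
qed

text \<open>
  Outside every \<open>maximal_level \<sigma> M\<close> no cell is heavy, so the part of \<open>{w > \<sigma>}\<close> there has average at most
  \<open>\<sigma>\<close> and is therefore null.
\<close>

lemma emeasure_level_set_le:
  assumes "0 \<le> \<sigma>" and c: "\<And>M. measure lebesgue (maximal_level \<sigma> M) \<le> c"
  shows "{x \<in> root. \<sigma> < w x} \<in> sets lebesgue"
    and "emeasure lebesgue {x \<in> root. \<sigma> < w x} \<le> ennreal c"
proof -
  have root[measurable]: "root \<in> sets lebesgue"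
    using dyadic_cell_lmeasurable(1)[OF l] by blast
  have [measurable]: "(\<lambda>x. indicat_real root x * w x) \<in> borel_measurable lebesgue"
    using integrable by (simp add: set_integrable_def)
  have "{x \<in> space lebesgue. x \<in> root \<and> \<sigma> < indicat_real root x * w x} \<in> sets lebesgue"
    by measurable
  moreover have "{x \<in> space lebesgue. x \<in> root \<and> \<sigma> < indicat_real root x * w x} = {x \<in> root. \<sigma> < w x}"
    by (auto simp: indicator_def)
  ultimately show L: "{x \<in> root. \<sigma> < w x} \<in> sets lebesgue"
    by (simp only:)
  let ?U = "\<Union>M. maximal_level \<sigma> M"
  have V: "maximal_level \<sigma> M \<in> sets lebesgue" for M
    using maximal_level_lmeasurable by blast
  define E where "E = {x \<in> root. \<sigma> < w x} - ?U"
  have E: "E \<in> sets lebesgue" "E \<subseteq> root"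
    unfolding E_def using L V by auto
  have E_fin: "E \<in> lmeasurable"
    using E dyadic_cell_lmeasurable(1)[OF l] by (metis fmeasurableI2)
  have int: "integrable lebesgue (\<lambda>x. indicat_real E x * w x)" "integrable lebesgue (\<lambda>x. indicat_real E x * \<sigma>)"
    using integrable_subset[OF E] E_fin by (auto simp: set_integrable_def fmeasurable_def)
  have "mass E \<le> \<sigma> * measure lebesgue E"
    using E by (intro mass_le_of_not_heavy assms(1)) (auto simp: E_def maximal_level_def)
  then have "(LINT x|lebesgue. indicat_real E x * w x - indicat_real E x * \<sigma>) \<le> 0"
    using int by (simp add: set_lebesgue_integral_def mult.commute)
  moreover have nn: "0 \<le> indicat_real E x * w x - indicat_real E x * \<sigma>" for x
    by (auto simp: indicator_def E_def)
  ultimately have "(LINT x|lebesgue. indicat_real E x * w x - indicat_real E x * \<sigma>) = 0"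
    by (intro antisym integral_nonneg_AE) auto
  then have "AE x in lebesgue. indicat_real E x * w x - indicat_real E x * \<sigma> = 0"
    using int nn by (subst (asm) integral_nonneg_eq_0_iff_AE) auto
  then have "AE x in lebesgue. x \<notin> E"
    by eventually_elim (auto simp: indicator_def E_def)
  then have "AE x in lebesgue. x \<in> {x \<in> root. \<sigma> < w x} \<longrightarrow> x \<in> ?U"
    by eventually_elim (auto simp: E_def)
  then have "emeasure lebesgue {x \<in> root. \<sigma> < w x} \<le> emeasure lebesgue ?U"
    using V by (intro emeasure_mono_AE) auto
  also have "\<dots> = (SUP M. emeasure lebesgue (maximal_level \<sigma> M))"
    using V maximal_level_mono by (intro SUP_emeasure_incseq[symmetric]) (auto simp: incseq_def)
  also have "\<dots> \<le> ennreal c"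
    using c maximal_level_lmeasurable by (auto intro!: SUP_least ennreal_leI simp: emeasure_eq_measure2)
  finally show "emeasure lebesgue {x \<in> root. \<sigma> < w x} \<le> ennreal c" .
qed

end

section \<open>Geometric decay of the level sets\<close>

text \<open>
  Jensen's inequality for the convex function \<open>x\<^sup>r\<close> with weights \<open>c\<close>.
\<close>

lemma powr_sum_le_sum_powr:
  fixes c x :: "'i \<Rightarrow> real"
  assumes "finite I" "1 \<le> r" and c: "\<And>i. i \<in> I \<Longrightarrow> 0 < c i" and x: "\<And>i. i \<in> I \<Longrightarrow> 0 \<le> x i"
  shows "(\<Sum>i\<in>I. c i * x i) powr r \<le> (\<Sum>i\<in>I. c i) powr (r - 1) * (\<Sum>i\<in>I. c i * x i powr r)"
proof -
  \<comment> \<open>Convexity of the real power is used on the open half-line, hence the restriction to positive \<open>x\<close>.\<close>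
  define I' where "I' = {i \<in> I. 0 < x i}"
  define S where "S = (\<Sum>i\<in>I'. c i)"
  have I': "finite I'" "I' \<subseteq> I"
    using assms(1) by (auto simp: I'_def)
  have restrict: "(\<Sum>i\<in>I. c i * x i) = (\<Sum>i\<in>I'. c i * x i)" 
      "(\<Sum>i\<in>I. c i * x i powr r) = (\<Sum>i\<in>I'. c i * x i powr r)"
    using assms(1) x by (auto simp: I'_def intro!: sum.mono_neutral_right) (smt (verit) x)+
  show ?thesis
  proof (cases "I' = {}")
    case True
    then show ?thesis
      unfolding restrict by simp
  next
    case False
    then have S: "0 < S"
      unfolding S_def using I' c by (intro sum_pos) auto
    have "(\<Sum>i\<in>I'. (c i / S) *\<^sub>R x i) powr r \<le> (\<Sum>i\<in>I'. c i / S * x i powr r)"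
    proof (rule convex_on_sum[OF I'(1) False powr_convex[OF assms(2)]])
      show "(\<Sum>i\<in>I'. c i / S) = 1"
        using S by (simp add: sum_divide_distrib[symmetric] S_def[symmetric])
    qed (use c S I' in \<open>auto simp: I'_def less_imp_le\<close>)
    then have "((\<Sum>i\<in>I'. c i * x i) / S) powr r \<le> (\<Sum>i\<in>I'. c i * x i powr r) / S"
      by (simp add: sum_divide_distrib)
    moreover have "0 \<le> (\<Sum>i\<in>I'. c i * x i)"
      using c x I' by (intro sum_nonneg mult_nonneg_nonneg) (auto intro: less_imp_le)
    ultimately have "(\<Sum>i\<in>I'. c i * x i) powr r \<le> S powr (r - 1) * (\<Sum>i\<in>I'. c i * x i powr r)"
      using S by (simp add: powr_divide powr_diff field_simps)
    also have "\<dots> \<le> (\<Sum>i\<in>I. c i) powr (r - 1) * (\<Sum>i\<in>I'. c i * x i powr r)"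
    proof (intro mult_right_mono powr_mono2)
      show "S \<le> (\<Sum>i\<in>I. c i)"
        unfolding S_def using I' assms(1) c by (intro sum_mono2) (auto intro: less_imp_le)
      show "0 \<le> (\<Sum>i\<in>I'. c i * x i powr r)"
        using c I' by (intro sum_nonneg mult_nonneg_nonneg) (auto intro: less_imp_le)
    qed (use S assms(2) in auto)
    finally show ?thesis
      unfolding restrict .
  qed
qed

text \<open>
  The tail \<open>T\<^sub>j = \<Sum>\<^sub>k b\<^bsub>j + k\<^esub>\<close> satisfies \<open>T\<^sub>j - T\<^bsub>j + 1\<^esub> = b\<^sub>j \<ge> T\<^sub>j / K\<close>, so it shrinks by the factor \<open>1 - 1 / K\<close> in
  each step.
\<close>

lemma geometric_decay:
  fixes b :: "nat \<Rightarrow> real"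
  assumes b: "\<And>k. 0 \<le> b k" and "1 \<le> K" and tail: "\<And>j n. (\<Sum>k<n. b (j + k)) \<le> K * b j"
  shows "b j \<le> K * (1 - 1 / K) ^ j * b 0"
proof -
  have sm: "summable (\<lambda>k. b (j + k))" for j
    using b tail by (intro summableI_nonneg_bounded) auto
  define T where "T = (\<lambda>j. \<Sum>k. b (j + k))"
  have T_le: "T j \<le> K * b j" for j
    unfolding T_def by (intro suminf_le_const sm tail)
  have T_Suc: "T j = b j + T (Suc j)" for j
    unfolding T_def using suminf_split_head[OF sm[of j]] by simp
  have T_nonneg: "0 \<le> T j" for j
    unfolding T_def using b sm by (intro suminf_nonneg) auto
  have "T j \<le> (1 - 1 / K) ^ j * T 0" for j
  proof (induction j)
    case (Suc j)
    have "T (Suc j) \<le> (1 - 1 / K) * T j"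
      using T_Suc[of j] T_le[of j] \<open>1 \<le> K\<close> by (simp add: field_simps)
    also have "\<dots> \<le> (1 - 1 / K) * ((1 - 1 / K) ^ j * T 0)"
      using Suc \<open>1 \<le> K\<close> by (intro mult_left_mono) auto
    finally show ?case by (simp add: mult.assoc)
  qed simp
  moreover have "(1 - 1 / K) ^ j * T 0 \<le> (1 - 1 / K) ^ j * (K * b 0)"
    using T_le[of 0] \<open>1 \<le> K\<close> by (intro mult_left_mono) auto
  moreover have "b j \<le> T j"
    using T_Suc[of j] T_nonneg[of "Suc j"] by simp
  ultimately have "b j \<le> (1 - 1 / K) ^ j * (K * b 0)"
    by (meson order_trans)
  then show ?thesis by (simp add: mult_ac)
qed

text \<open>
  What remains of the reverse Holder inequality for \<open>L(p,q)\<close> in the decay argument: it mentions only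
  measures and averages, with \<open>r = q / p\<close>.
\<close>

definition level_packing :: "real \<Rightarrow> real \<Rightarrow> real \<Rightarrow> (real ^ 'n \<Rightarrow> real) \<Rightarrow> bool" where
  "level_packing q r A w \<longleftrightarrow> (\<forall>Q\<in>cubes. \<forall>s>0. \<forall>E n.
    (\<forall>k. E k \<in> lmeasurable \<and> E k \<subseteq> Q \<and> 2 ^ k * s * measure lebesgue (E k) \<le> (LINT x:E k|lebesgue. w x)) \<longrightarrow>
    (\<Sum>k<n. (2 ^ k * s) powr q * measure lebesgue (E k) powr r) \<le>
      A * ((LINT x:Q|lebesgue. w x) / measure lebesgue Q) powr q * measure lebesgue Q powr r)"

text \<open>
  The fraction is the sum of a geometric series over the levels \<open>2\<^sup>k u\<close>, with the ratio \<open>1 - 1 / K\<close> raised to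
  \<open>p / q\<close>. The summand \<open>1\<close> stands for the part of the root where \<open>w \<le> u\<close>.
\<close>

definition reverse_Holder_const :: "real \<Rightarrow> real \<Rightarrow> real \<Rightarrow> real" where
  "reverse_Holder_const p q K = 1 + 2 powr p * K powr (p / q) / (1 - (1 - 1 / K) powr (p / q))"

context dyadic_stopping
begin

text \<open>
  On each stopping cell \<open>R\<close> of the level \<open>s\<close>, the packing condition applies to the traces of the higher
  level sets, and the average over \<open>R\<close> that it produces is at most \<open>2\<^sup>n s\<close>. The local bounds
  are combined by Jensen's inequality with the weights \<open>\<bar>R\<bar>\<close>, which is where \<open>r \<ge> 1\<close> enters.
\<close>

lemma sum_levels_le:
  assumes loc: "\<And>Q. Q \<in> cubes \<Longrightarrow> set_integrable lebesgue Q w"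
    and pack: "level_packing q r A w" and "0 \<le> A" "1 \<le> r" "0 < q"
    and "0 < s" and light: "\<not> heavy s root"
  shows "(\<Sum>k<n. (2 ^ k * s) powr q * measure lebesgue (maximal_level (2 ^ k * s) M) powr r)
    \<le> A * (2 ^ CARD('n)) powr q * s powr q * measure lebesgue (maximal_level s M) powr r"
proof -
  define V where "V = (\<lambda>k. maximal_level (2 ^ k * s) M)"
  let ?F = "stopping_cells s M" and ?m = "measure lebesgue" and ?N = "2 ^ CARD('n) :: real"
  have s_le: "s \<le> 2 ^ k * s" for k
    using \<open>0 < s\<close> by simp
  have V_sub: "V k \<subseteq> maximal_level s M" for k
    unfolding V_def by (rule maximal_level_antimono[OF s_le])
  have V_sets: "V k \<in> sets lebesgue" for k
    unfolding V_def using maximal_level_lmeasurable by blast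
  have cell_bound: "(\<Sum>k<n. (2 ^ k * s) powr q * ?m (V k \<inter> R) powr r) \<le> A * (?N * s) powr q * ?m R powr r"
    if R: "R \<in> ?F" for R
  proof -
    obtain Q where Q: "Q \<in> cubes" "R \<subseteq> Q" "negligible (Q - R)"
      using R dyadic_cell_cube[OF l] unfolding stopping_cells_def by (smt (verit) mem_Collect_eq)
    note R_meas = stopping_cells_lmeasurable[OF R]
    have eqs: "?m Q = ?m R" "(LINT x:Q|lebesgue. w x) = mass R"
      using negligible_Diff_measure[OF R_meas Q(2,3)]
        negligible_Diff_set_integral[OF loc[OF Q(1)] _ Q(2,3)] R_meas by auto
    have "V k \<inter> R \<in> lmeasurable" for k
      using V_sets[of k] R_meas by (metis fmeasurable_Int_fmeasurable inf_commute)
    then have "(\<Sum>k<n. (2 ^ k * s) powr q * ?m (V k \<inter> R) powr r) \<le> A * (mass R / ?m R) powr q * ?m R powr r"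
      using pack[unfolded level_packing_def, rule_format, OF Q(1) \<open>0 < s\<close>, of "\<lambda>k. V k \<inter> R" n] Q(2)
        mass_maximal_level_Int_ge[OF s_le R] unfolding eqs V_def by blast
    also have "\<dots> \<le> A * (?N * s) powr q * ?m R powr r"
    proof (intro mult_right_mono mult_left_mono powr_mono2)
      have "heavy s R"
        using R by (auto simp: stopping_cells_def)
      then have "0 \<le> mass R"
        using \<open>0 < s\<close> measure_nonneg[of lebesgue R] unfolding heavy_def
        by (smt (verit) mult_nonneg_nonneg)
      then show "0 \<le> mass R / ?m R"
        by simp
      show "mass R / ?m R \<le> ?N * s"
        using mass_cell_le[OF light R] stopping_cells_pos[OF R] by (simp add: pos_divide_le_eq)
    qed (use assms in auto)
    finally show ?thesis .
  qed
  have "(2 ^ k * s) powr q * ?m (V k) powr r \<le>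
      ?m (maximal_level s M) powr (r - 1) * (\<Sum>R\<in>?F. ?m R powr (1 - r) * ((2 ^ k * s) powr q * ?m (V k \<inter> R) powr r))" for k
  proof -
    have "?m (V k) = (\<Sum>R\<in>?F. ?m (V k \<inter> R))"
      using V_sub[of k] V_sets stopping_cells_lmeasurable
      by (intro measure_sum_disjoint finite_stopping_cells disjoint_family_stopping_cells)
        (auto simp: Union_stopping_cells)
    also have "\<dots> = (\<Sum>R\<in>?F. ?m R * (?m (V k \<inter> R) / ?m R))"
      using stopping_cells_pos by (intro sum.cong) (auto simp: less_le)
    finally have "?m (V k) powr r \<le> (\<Sum>R\<in>?F. ?m R) powr (r - 1) * (\<Sum>R\<in>?F. ?m R * (?m (V k \<inter> R) / ?m R) powr r)"
      using stopping_cells_pos \<open>1 \<le> r\<close> by (simp only:) (intro powr_sum_le_sum_powr finite_stopping_cells; simp)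
    also have "(\<Sum>R\<in>?F. ?m R) = ?m (maximal_level s M)"
      by (rule measure_maximal_level[symmetric])
    also have "(\<Sum>R\<in>?F. ?m R * (?m (V k \<inter> R) / ?m R) powr r) = (\<Sum>R\<in>?F. ?m R powr (1 - r) * ?m (V k \<inter> R) powr r)"
      using stopping_cells_pos by (intro sum.cong) (auto simp: powr_divide powr_diff less_imp_le)
    finally have "(2 ^ k * s) powr q * ?m (V k) powr r \<le> (2 ^ k * s) powr q *
        (?m (maximal_level s M) powr (r - 1) * (\<Sum>R\<in>?F. ?m R powr (1 - r) * ?m (V k \<inter> R) powr r))"
      by (intro mult_left_mono) auto
    then show ?thesis
      by (simp add: sum_distrib_left mult_ac)
  qed
  then have "(\<Sum>k<n. (2 ^ k * s) powr q * ?m (V k) powr r) \<le> (\<Sum>k<n. ?m (maximal_level s M) powr (r - 1) * 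
      (\<Sum>R\<in>?F. ?m R powr (1 - r) * ((2 ^ k * s) powr q * ?m (V k \<inter> R) powr r)))"
    by (intro sum_mono)
  also have "\<dots> = ?m (maximal_level s M) powr (r - 1) *
      (\<Sum>R\<in>?F. ?m R powr (1 - r) * (\<Sum>k<n. (2 ^ k * s) powr q * ?m (V k \<inter> R) powr r))"
    unfolding sum_distrib_left by (rule sum.swap)
  also have "\<dots> \<le> ?m (maximal_level s M) powr (r - 1) *
      (\<Sum>R\<in>?F. ?m R powr (1 - r) * (A * (?N * s) powr q * ?m R powr r))"
    by (intro mult_left_mono sum_mono cell_bound) auto
  also have "(\<Sum>R\<in>?F. ?m R powr (1 - r) * (A * (?N * s) powr q * ?m R powr r)) = A * (?N * s) powr q * (\<Sum>R\<in>?F. ?m R)"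
    unfolding sum_distrib_left
    using stopping_cells_pos by (intro sum.cong) (auto simp: powr_diff)
  also have "(\<Sum>R\<in>?F. ?m R) = ?m (maximal_level s M)"
    by (rule measure_maximal_level[symmetric])
  also have "?m (maximal_level s M) powr (r - 1) * (A * (?N * s) powr q * ?m (maximal_level s M)) =
      A * (?N * s) powr q * ?m (maximal_level s M) powr r"
    by (cases "?m (maximal_level s M) = 0") (auto simp: powr_diff measure_le_0_iff)
  finally show ?thesis
    using \<open>0 < s\<close> by (simp add: V_def powr_mult mult_ac)
qed

lemma root_pos: "0 < measure lebesgue root"
  unfolding dyadic_cell_lmeasurable(2)[OF l] using l by simp

text \<open>
  The sequence \<open>b\<^sub>k = (2\<^sup>k u)\<^sup>q \<bar>V\<bar>\<^sup>r\<close>, with \<open>V\<close> the level set at \<open>2\<^sup>k u\<close>, decays geometrically at a rate that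
  does not depend on the truncation \<open>M\<close>; the bound \<open>K \<ge> 1\<close> keeps the ratio \<open>1 - 1 / K\<close> nonnegative.
  Taking \<open>r\<close>-th roots turns the weight \<open>(2\<^sup>k)\<^sup>q\<close> into \<open>(2\<^sup>k)\<^sup>p\<close>.
\<close>

lemma emeasure_high_level_le:
  fixes p q A :: real
  defines "K \<equiv> max 1 (A * (2 ^ CARD('n)) powr q)" and "u \<equiv> mass root / measure lebesgue root"
  assumes loc: "\<And>Q. Q \<in> cubes \<Longrightarrow> set_integrable lebesgue Q w"
    and pack: "level_packing q (q / p) A w" and "0 \<le> A" "0 < p" "p \<le> q" and "0 < u"
  shows "emeasure lebesgue {x \<in> root. 2 ^ k * u < w x}
    \<le> ennreal ((K * (1 - 1 / K) ^ k) powr (p / q) * measure lebesgue root / (2 ^ k) powr p)"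
proof (rule emeasure_level_set_le(2))
  show "0 \<le> 2 ^ k * u"
    using \<open>0 < u\<close> by simp
  fix M
  let ?m = "measure lebesgue"
  define r where "r = q / p"
  have r: "1 \<le> r" "q = r * p" "0 < q"
    using assms(6,7) by (auto simp: r_def)
  define b where "b = (\<lambda>k. (2 ^ k * u) powr q * ?m (maximal_level (2 ^ k * u) M) powr r)"
  have K: "1 \<le> K" "A * (2 ^ CARD('n)) powr q \<le> K"
    by (auto simp: K_def)
  \<comment> \<open>The average over the root is \<open>u\<close> itself, and being heavy is a strict inequality, so \<open>j = 0\<close> is included.\<close>
  have light: "\<not> heavy (2 ^ j * u) root" for j
  proof -
    have "mass root = u * measure lebesgue root"
      using root_pos by (simp add: u_def)
    also have "\<dots> \<le> 2 ^ j * u * measure lebesgue root"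
      using root_pos \<open>0 < u\<close> by simp
    finally show ?thesis
      by (simp add: heavy_def)
  qed
  have tail: "(\<Sum>k<n. b (j + k)) \<le> K * b j" for j n
  proof -
    have "(\<Sum>k<n. b (j + k)) = (\<Sum>k<n. (2 ^ k * (2 ^ j * u)) powr q * ?m (maximal_level (2 ^ k * (2 ^ j * u)) M) powr r)"
      by (simp add: b_def power_add mult_ac)
    also have "\<dots> \<le> A * (2 ^ CARD('n)) powr q * (2 ^ j * u) powr q * ?m (maximal_level (2 ^ j * u) M) powr r"
      by (rule sum_levels_le[OF loc pack[folded r_def] assms(5) r(1,3) _ light]) (use \<open>0 < u\<close> in simp_all)
    also have "\<dots> \<le> K * b j"
      unfolding b_def mult.assoc[symmetric] by (intro mult_right_mono K) auto
    finally show ?thesis .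
  qed
  have "b k \<le> K * (1 - 1 / K) ^ k * b 0"
    by (rule geometric_decay[OF _ K(1) tail]) (simp add: b_def)
  also have "\<dots> \<le> K * (1 - 1 / K) ^ k * (u powr q * ?m root powr r)"
  proof (intro mult_left_mono)
    have "?m (maximal_level u M) powr r \<le> ?m root powr r"
      using maximal_level_subset_root maximal_level_lmeasurable dyadic_cell_lmeasurable(1)[OF l] r
      by (intro powr_mono2 measure_mono_fmeasurable) auto
    then show "b 0 \<le> u powr q * ?m root powr r"
      by (simp add: b_def mult_left_mono)
  qed (use K in auto)
  finally have "(2 ^ k) powr q * ?m (maximal_level (2 ^ k * u) M) powr r \<le> K * (1 - 1 / K) ^ k * ?m root powr r"
    using \<open>0 < u\<close> by (simp add: b_def powr_mult mult_ac)
  then have "((2 ^ k) powr q * ?m (maximal_level (2 ^ k * u) M) powr r) powr (1 / r)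
      \<le> (K * (1 - 1 / K) ^ k * ?m root powr r) powr (1 / r)"
    using r by (intro powr_mono2) auto
  then have "(2 ^ k) powr p * ?m (maximal_level (2 ^ k * u) M) \<le> (K * (1 - 1 / K) ^ k) powr (p / q) * ?m root"
    using r K assms(6) by (simp add: powr_mult powr_powr)
  then show "?m (maximal_level (2 ^ k * u) M) \<le> (K * (1 - 1 / K) ^ k) powr (p / q) * ?m root / (2 ^ k) powr p"
    by (simp add: pos_le_divide_eq mult.commute)
qed

text \<open>
  On \<open>{2\<^sup>k u < w \<le> 2\<^bsup>k + 1\<^esup> u}\<close> the integrand is at most \<open>2\<^sup>p (2\<^sup>k u)\<^sup>p\<close>, which the factor \<open>(2\<^sup>k)\<^sup>p\<close> in the
  preceding estimate cancels, and a geometric series remains.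
\<close>

lemma nn_integral_powr_le:
  fixes p q A :: real
  defines "K \<equiv> max 1 (A * (2 ^ CARD('n)) powr q)" and "u \<equiv> mass root / measure lebesgue root"
  assumes loc: "\<And>Q. Q \<in> cubes \<Longrightarrow> set_integrable lebesgue Q w"
    and pack: "level_packing q (q / p) A w" and "0 \<le> A" "0 < p" "p \<le> q" and "0 < u"
  shows "(\<integral>\<^sup>+ x\<in>root. ennreal (w x powr p) \<partial>lebesgue) \<le> ennreal (reverse_Holder_const p q K * u powr p * measure lebesgue root)"
proof -
  let ?m = "measure lebesgue"
  define E where "E = (\<lambda>k::nat. {x \<in> root. 2 ^ k * u < w x})"
  define \<theta> where "\<theta> = (1 - 1 / K) powr (p / q)"
  define c where "c = 2 powr p * K powr (p / q) * u powr p * ?m root"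
  have K: "1 \<le> K"
    by (simp add: K_def)
  have \<theta>: "0 \<le> \<theta>" "\<theta> < 1"
    using K assms(6,7) powr_less_mono2[of "p / q" "1 - 1 / K" 1] by (simp_all add: \<theta>_def)
  have root_sets: "root \<in> sets lebesgue"
    using dyadic_cell_lmeasurable(1)[OF l] by blast
  have E_sets: "E k \<in> sets lebesgue" for k
    unfolding E_def using \<open>0 < u\<close> measure_mono_fmeasurable[OF maximal_level_subset_root _ dyadic_cell_lmeasurable(1)[OF l]]
      maximal_level_lmeasurable by (intro emeasure_level_set_le(1)[where c="?m root"]) auto
  have pointwise: "ennreal (w x powr p) * indicator root x \<le>
      ennreal (u powr p) * indicator root x + (\<Sum>k. ennreal ((2 ^ Suc k * u) powr p) * indicator (E k) x)"
    if "0 \<le> w x" for x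
  proof (cases "x \<in> root \<and> u < w x")
    case False
    then show ?thesis
      using that assms(6) by (auto simp: indicator_def intro!: ennreal_leI powr_mono2 add_increasing2)
  next
    case True
    \<comment> \<open>Minimality makes this the level with \<open>2\<^sup>k u < w x \<le> 2\<^bsup>k + 1\<^esup> u\<close>; for \<open>k = 0\<close> the lower bound is \<open>u < w x\<close>.\<close>
    define k where "k = (LEAST k. w x \<le> 2 ^ Suc k * u)"
    obtain k0 where "w x / u < 2 ^ k0"
      using real_arch_pow[of 2 "w x / u"] by auto
    then have "w x \<le> 2 ^ Suc k0 * u"
      using \<open>0 < u\<close> that by (simp add: pos_divide_less_eq)
    then have k: "w x \<le> 2 ^ Suc k * u"
      unfolding k_def by (rule LeastI)
    have "2 ^ k * u < w x"
    proof (cases k)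
      case (Suc j)
      then have "\<not> w x \<le> 2 ^ Suc j * u"
        unfolding k_def by (intro not_less_Least) simp
      then show ?thesis using Suc by simp
    qed (use True in simp)
    then have "x \<in> E k"
      using True by (simp add: E_def)
    then have "ennreal (w x powr p) * indicator root x \<le> (\<Sum>j\<in>{k}. ennreal ((2 ^ Suc j * u) powr p) * indicator (E j) x)"
      using k that assms(6) True by (auto intro!: ennreal_leI powr_mono2)
    also have "\<dots> \<le> (\<Sum>k. ennreal ((2 ^ Suc k * u) powr p) * indicator (E k) x)"
      by (intro sum_le_suminf) auto
    finally show ?thesis
      by (simp add: add_increasing)
  qed
  have level_term: "ennreal ((2 ^ Suc k * u) powr p) * emeasure lebesgue (E k) \<le> ennreal (c * \<theta> ^ k)" for k
  proof -
    have scale: "(2 ^ Suc k * u) powr p = 2 powr p * (2 ^ k) powr p * u powr p"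
      using \<open>0 < u\<close> by (simp add: powr_mult)
    have "(y ^ k) powr e = (y powr e) ^ k" if "0 \<le> y" for y e :: real
      using that by (induction k) (auto simp: powr_mult)
    then have decay: "(K * (1 - 1 / K) ^ k) powr (p / q) = K powr (p / q) * \<theta> ^ k"
      using K by (simp add: \<theta>_def powr_mult)
    have "ennreal ((2 ^ Suc k * u) powr p) * emeasure lebesgue (E k) \<le> ennreal ((2 ^ Suc k * u) powr p) *
        ennreal ((K * (1 - 1 / K) ^ k) powr (p / q) * ?m root / (2 ^ k) powr p)"
      unfolding E_def K_def u_def
      by (intro mult_left_mono emeasure_high_level_le assms(3-7)) (use assms(8) in \<open>auto simp: u_def\<close>)
    also have "\<dots> = ennreal ((2 ^ Suc k * u) powr p * ((K * (1 - 1 / K) ^ k) powr (p / q) * ?m root / (2 ^ k) powr p))"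
      by (intro ennreal_mult[symmetric]) auto
    also have "\<dots> = ennreal (c * \<theta> ^ k)"
      unfolding scale decay by (simp add: c_def mult_ac)
    finally show ?thesis .
  qed
  have "(\<integral>\<^sup>+ x\<in>root. ennreal (w x powr p) \<partial>lebesgue) \<le>
      (\<integral>\<^sup>+ x. ennreal (u powr p) * indicator root x + (\<Sum>k. ennreal ((2 ^ Suc k * u) powr p) * indicator (E k) x) \<partial>lebesgue)"
    using nonneg by (intro nn_integral_mono_AE, elim eventually_mono) (rule pointwise)
  also have "\<dots> = ennreal (u powr p) * emeasure lebesgue root + (\<Sum>k. ennreal ((2 ^ Suc k * u) powr p) * emeasure lebesgue (E k))"
    using root_sets E_sets by (simp add: nn_integral_add nn_integral_suminf nn_integral_cmult_indicator)
  also have "\<dots> \<le> ennreal (u powr p * ?m root) + (\<Sum>k. ennreal (c * \<theta> ^ k))"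
    using dyadic_cell_lmeasurable(1)[OF l, of a 0 a]
    by (intro add_mono suminf_le level_term) (auto simp: emeasure_eq_measure2 ennreal_mult)
  also have "(\<Sum>k. ennreal (c * \<theta> ^ k)) = ennreal (c / (1 - \<theta>))"
  proof -
    have "(\<lambda>k. c * \<theta> ^ k) sums (c * (1 / (1 - \<theta>)))"
      using \<theta> by (intro sums_mult geometric_sums) auto
    moreover have "0 \<le> c"
      by (simp add: c_def)
    ultimately show ?thesis
      using \<theta> by (intro suminf_ennreal_eq) auto
  qed
  also have "ennreal (u powr p * ?m root) + ennreal (c / (1 - \<theta>)) = ennreal (u powr p * ?m root + c / (1 - \<theta>))"
    using \<theta> by (intro ennreal_plus[symmetric]) (auto simp: c_def)
  also have "u powr p * ?m root + c / (1 - \<theta>) = reverse_Holder_const p q K * u powr p * ?m root"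
    by (simp add: reverse_Holder_const_def c_def \<theta>_def[symmetric] distrib_right)
  finally show ?thesis .
qed

end

section \<open>Comparison of the two reverse Holder classes\<close>

lemma weight_integrable_cube: "weight w \<Longrightarrow> Q \<in> cubes \<Longrightarrow> set_integrable lebesgue Q w"
  by (auto simp: weight_def locally_integrable_def cubes_def)

lemma weight_nonneg: "weight w \<Longrightarrow> AE x in lebesgue. 0 \<le> w x"
  unfolding weight_def by (auto elim: eventually_mono)

lemma weight_mass_pos:
  assumes "weight w" "Q \<in> cubes"
  shows "0 < (LINT x:Q|lebesgue. w x)"
proof -
  have pos: "AE x in lebesgue. 0 < w x"
    using assms(1) by (simp add: weight_def)
  have nn: "AE x in lebesgue. 0 \<le> indicat_real Q x *\<^sub>R w x"
    using pos by eventually_elim (simp add: indicator_def)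
  have int: "integrable lebesgue (\<lambda>x. indicat_real Q x *\<^sub>R w x)"
    using weight_integrable_cube[OF assms] by (simp add: set_integrable_def)
  have "(LINT x:Q|lebesgue. w x) \<noteq> 0"
  proof
    assume "(LINT x:Q|lebesgue. w x) = 0"
    then have "AE x in lebesgue. indicat_real Q x *\<^sub>R w x = 0"
      using integral_nonneg_eq_0_iff_AE[OF int nn] by (simp add: set_lebesgue_integral_def)
    with pos have "AE x in lebesgue. x \<notin> Q"
      by eventually_elim (auto simp: indicator_def)
    then have "measure lebesgue Q = 0"
      using cubes_lmeasurable[OF assms(2)] by (subst (asm) AE_iff_measurable[where N=Q]) (auto simp: measure_def)
    then show False
      using cubes_measure_pos[OF assms(2)] by simp
  qed
  moreover have "0 \<le> (LINT x:Q|lebesgue. w x)"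
    using nn unfolding set_lebesgue_integral_def by (rule integral_nonneg_AE)
  ultimately show ?thesis by simp
qed

lemma weight_restrict_measurable:
  assumes "weight w" "Q \<in> cubes"
  shows "(\<lambda>x. w x * indicator Q x) \<in> borel_measurable lebesgue"
  using weight_integrable_cube[OF assms] by (auto simp: set_integrable_def mult.commute)

text \<open>
  The \<open>q\<close>-th power of the reverse Holder inequality bounds the right-hand side of
  \<open>sum_levels_le_Lorentz_norm\<close> for \<open>f = w \<chi>\<^sub>Q\<close>.
\<close>

lemma level_packing_of_RH_Lorentz:
  fixes w :: "real ^ 'n \<Rightarrow> real"
  assumes w: "weight w" and p: "1 < p" "p \<le> q" and "0 < C"
    and RH: "\<And>Q. Q \<in> cubes \<Longrightarrow>
      Lorentz_norm p q (\<lambda>x. w x * indicator Q x) / ennreal (measure lebesgue Q powr (1 / p))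
        \<le> ennreal (C / measure lebesgue Q * (LINT x:Q|lebesgue. w x))"
  shows "level_packing q (q / p) (2 * 2 powr (q / p) * C powr q) w"
  unfolding level_packing_def
proof (intro ballI allI impI)
  fix Q :: "(real ^ 'n) set" and s :: real and E :: "nat \<Rightarrow> (real ^ 'n) set" and n
  assume Q: "Q \<in> cubes" and s: "0 < s"
    and E: "\<forall>k. E k \<in> lmeasurable \<and> E k \<subseteq> Q \<and> 2 ^ k * s * measure lebesgue (E k) \<le> (LINT x:E k|lebesgue. w x)"
  let ?m = "measure lebesgue Q"
  define u where "u = (LINT x:Q|lebesgue. w x) / ?m"
  define f where "f = (\<lambda>x. w x * indicator Q x)"
  have m: "0 < ?m" and u: "0 < u"
    using cubes_measure_pos[OF Q] weight_mass_pos[OF w Q] by (auto simp: u_def)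
  have f: "f \<in> borel_measurable lebesgue"
    unfolding f_def by (rule weight_restrict_measurable[OF w Q])
  have avg: "ennreal (2 ^ k * s * measure lebesgue (E k)) \<le> (\<integral>\<^sup>+ x\<in>E k. ennreal \<bar>f x\<bar> \<partial>lebesgue)" for k
  proof -
    have "set_integrable lebesgue (E k) w"
      using E by (intro set_integrable_subset[OF weight_integrable_cube[OF w Q]]) auto
    then have int: "integrable lebesgue (\<lambda>x. indicat_real (E k) x *\<^sub>R w x)"
      by (simp add: set_integrable_def)
    have "ennreal (2 ^ k * s * measure lebesgue (E k)) \<le> ennreal (norm (LINT x:E k|lebesgue. w x))"
      using E by (intro ennreal_leI) (auto intro: order_trans)
    also have "\<dots> \<le> (\<integral>\<^sup>+ x. ennreal (norm (indicat_real (E k) x *\<^sub>R w x)) \<partial>lebesgue)"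
      unfolding set_lebesgue_integral_def by (rule integral_norm_bound_ennreal[OF int])
    also have "\<dots> = (\<integral>\<^sup>+ x\<in>E k. ennreal \<bar>f x\<bar> \<partial>lebesgue)"
      using E by (intro nn_integral_cong) (auto simp: f_def indicator_def)
    finally show ?thesis .
  qed
  have "Lorentz_norm p q f \<le> ennreal (C * u * ?m powr (1 / p))"
  proof -
    have "Lorentz_norm p q f / ennreal (?m powr (1 / p)) \<le> ennreal (C * u)"
      using RH[OF Q] by (simp add: f_def u_def)
    then have "Lorentz_norm p q f / ennreal (?m powr (1 / p)) * ennreal (?m powr (1 / p))
        \<le> ennreal (C * u) * ennreal (?m powr (1 / p))"
      by (rule mult_right_mono) simp
    moreover have "Lorentz_norm p q f / ennreal (?m powr (1 / p)) * ennreal (?m powr (1 / p)) = Lorentz_norm p q f"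
      using m by (simp add: ennreal_divide_times)
    ultimately show ?thesis
      using u \<open>0 < C\<close> by (simp add: ennreal_mult)
  qed
  then have "ennpowr (Lorentz_norm p q f) q \<le> ennpowr (ennreal (C * u * ?m powr (1 / p))) q"
    using p by (intro ennpowr_mono) auto
  also have "\<dots> = ennreal (C powr q * u powr q * ?m powr (q / p))"
    using u \<open>0 < C\<close> by (simp add: ennpowr_ennreal powr_mult powr_powr)
  finally have norm: "ennpowr (Lorentz_norm p q f) q \<le> ennreal (C powr q * u powr q * ?m powr (q / p))" .
  have "ennreal (\<Sum>k<n. (2 ^ k * s) powr q * measure lebesgue (E k) powr (q / p))
      \<le> ennreal (2 * 2 powr (q / p)) * ennpowr (Lorentz_norm p q f) q"
    using E by (intro sum_levels_le_Lorentz_norm p s f avg) auto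
  also have "\<dots> \<le> ennreal (2 * 2 powr (q / p)) * ennreal (C powr q * u powr q * ?m powr (q / p))"
    by (intro mult_left_mono norm) simp
  also have "\<dots> = ennreal (2 * 2 powr (q / p) * C powr q * u powr q * ?m powr (q / p))"
    by (subst ennreal_mult[symmetric]) (auto simp: mult.assoc)
  finally show "(\<Sum>k<n. (2 ^ k * s) powr q * measure lebesgue (E k) powr (q / p))
      \<le> 2 * 2 powr (q / p) * C powr q * ((LINT x:Q|lebesgue. w x) / ?m) powr q * ?m powr (q / p)"
    unfolding u_def by (subst (asm) ennreal_le_iff) auto
qed

lemma reverse_Holder_const_ge_1:
  fixes p q K :: real
  assumes "0 < p" "p \<le> q" "1 \<le> K"
  shows "1 \<le> reverse_Holder_const p q K"
proof -
  have "(1 - 1 / K) powr (p / q) < 1"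
    using assms powr_less_mono2[of "p / q" "1 - 1 / K" 1] by simp
  then show ?thesis
    by (simp add: reverse_Holder_const_def)
qed

text \<open>
  The constant \<open>D\<close> bounds the average of \<open>w\<^sup>p\<close> relative to the \<open>p\<close>-th power of the average of \<open>w\<close>. It depends on
  the weight only through \<open>C\<close>, hence it is the same for all cubes.
\<close>

lemma RH_Lorentz_subset_RH:
  assumes p: "1 < p" "p \<le> q"
  shows "(RH_Lorentz p q :: (real ^ 'n \<Rightarrow> real) set) \<subseteq> RH p"
proof
  fix w :: "real ^ 'n \<Rightarrow> real" assume "w \<in> RH_Lorentz p q"
  then obtain C where w: "weight w" and "0 < C"
    and RH: "\<And>Q. Q \<in> cubes \<Longrightarrow>
      Lorentz_norm p q (\<lambda>x. w x * indicator Q x) / ennreal (measure lebesgue Q powr (1 / p))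
        \<le> ennreal (C / measure lebesgue Q * (LINT x:Q|lebesgue. w x))"
    unfolding RH_Lorentz_def by blast
  define A where "A = 2 * 2 powr (q / p) * C powr q"
  define D where "D = reverse_Holder_const p q (max 1 (A * (2 ^ CARD('n)) powr q))"
  have pack: "level_packing q (q / p) A w"
    unfolding A_def by (rule level_packing_of_RH_Lorentz[OF w p \<open>0 < C\<close> RH])
  have D: "1 \<le> D"
    unfolding D_def using p by (intro reverse_Holder_const_ge_1) auto
  have "ennpowr ((\<integral>\<^sup>+ x \<in> Q. ennreal (w x powr p) \<partial>lebesgue) / ennreal (measure lebesgue Q)) (1 / p)
      \<le> ennreal (D powr (1 / p) * (1 / measure lebesgue Q * (LINT x:Q|lebesgue. w x)))"
    if Q: "Q \<in> cubes" for Q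
  proof -
    let ?m = "measure lebesgue Q"
    define u where "u = (LINT x:Q|lebesgue. w x) / ?m"
    have m: "0 < ?m" and u: "0 < u"
      using cubes_measure_pos[OF Q] weight_mass_pos[OF w Q] by (auto simp: u_def)
    obtain a l where l: "0 < l" and root: "dyadic_cell a l 0 a \<subseteq> Q" "negligible (Q - dyadic_cell a l 0 a)"
      using cube_eq_dyadic_root[OF Q] by blast
    let ?R = "dyadic_cell a l 0 a"
    have R: "?R \<in> lmeasurable" "?R \<in> sets lebesgue"
      using dyadic_cell_lmeasurable(1)[OF l] by blast+
    interpret dyadic_stopping a l w
      using l set_integrable_subset[OF weight_integrable_cube[OF w Q] R(2) root(1)] weight_nonneg[OF w]
      by unfold_locales
    have eqs: "?m = measure lebesgue ?R" "(LINT x:Q|lebesgue. w x) = (LINT x:?R|lebesgue. w x)"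
      using negligible_Diff_measure[OF R(1) root]
        negligible_Diff_set_integral[OF weight_integrable_cube[OF w Q] R(2) root] by auto
    have "(\<integral>\<^sup>+ x \<in> Q. ennreal (w x powr p) \<partial>lebesgue) = (\<integral>\<^sup>+ x \<in> ?R. ennreal (w x powr p) \<partial>lebesgue)"
      using AE_indicator_negligible_Diff[OF root, where 'b=ennreal] by (intro nn_integral_cong_AE) (auto elim: eventually_mono)
    also have "\<dots> \<le> ennreal (D * u powr p * ?m)"
      using nn_integral_powr_le[OF weight_integrable_cube[OF w] pack] u p \<open>0 < C\<close>
      unfolding D_def u_def eqs by (simp add: A_def)
    finally have "(\<integral>\<^sup>+ x \<in> Q. ennreal (w x powr p) \<partial>lebesgue) / ennreal ?m \<le> ennreal (D * u powr p * ?m) / ennreal ?m"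
      by (rule divide_right_mono_ennreal)
    also have "\<dots> = ennreal (D * u powr p)"
      using m D by (simp add: divide_ennreal)
    finally have "ennpowr ((\<integral>\<^sup>+ x \<in> Q. ennreal (w x powr p) \<partial>lebesgue) / ennreal ?m) (1 / p)
        \<le> ennpowr (ennreal (D * u powr p)) (1 / p)"
      using p by (intro ennpowr_mono) auto
    also have "\<dots> = ennreal (D powr (1 / p) * u)"
      using D u p by (simp add: ennpowr_ennreal powr_mult powr_powr)
    finally show ?thesis
      by (simp add: u_def)
  qed
  moreover have "0 < D powr (1 / p)"
    using D by simp
  ultimately show "w \<in> RH p"
    unfolding RH_def using w by blast
qed

lemma RH_subset_RH_Lorentz:
  assumes p: "1 < p" "p \<le> q"
  shows "RH p \<subseteq> (RH_Lorentz p q :: (real ^ 'n \<Rightarrow> real) set)"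
proof
  fix w :: "real ^ 'n \<Rightarrow> real" assume "w \<in> RH p"
  then obtain C where w: "weight w" and C: "0 < C"
    and RH: "\<And>Q. Q \<in> cubes \<Longrightarrow>
      ennpowr ((\<integral>\<^sup>+ x \<in> Q. ennreal (w x powr p) \<partial>lebesgue) / ennreal (measure lebesgue Q)) (1 / p)
        \<le> ennreal (C * (1 / measure lebesgue Q * (LINT x:Q|lebesgue. w x)))"
    unfolding RH_def by blast
  define D where "D = (2 powr (q - p) * (p * 2 powr p / (p - 1))) powr (1 / q)"
  have D: "0 < D"
    using p by (simp add: D_def)
  have "Lorentz_norm p q (\<lambda>x. w x * indicator Q x) / ennreal (measure lebesgue Q powr (1 / p))
      \<le> ennreal (D * C / measure lebesgue Q * (LINT x:Q|lebesgue. w x))"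
    if Q: "Q \<in> cubes" for Q
  proof -
    let ?m = "measure lebesgue Q" and ?f = "\<lambda>x. w x * indicator Q x"
    define u where "u = (LINT x:Q|lebesgue. w x) / ?m"
    have m: "0 < ?m" and u: "0 < u"
      using cubes_measure_pos[OF Q] weight_mass_pos[OF w Q] by (auto simp: u_def)
    have pos: "0 < (C * u) powr p * ?m"
      using m u C by simp
    let ?I = "\<integral>\<^sup>+ x \<in> Q. ennreal (w x powr p) \<partial>lebesgue"
    have "ennpowr (?I / ennreal ?m) (1 / p) \<le> ennreal (C * u)"
      using RH[OF Q] by (simp add: u_def)
    then have "ennpowr (ennpowr (?I / ennreal ?m) (1 / p)) p \<le> ennpowr (ennreal (C * u)) p"
      using p by (intro ennpowr_mono) auto
    then have "?I / ennreal ?m \<le> ennreal ((C * u) powr p)"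
      using p C u by (simp add: ennpowr_inverse ennpowr_ennreal)
    then have "?I / ennreal ?m * ennreal ?m \<le> ennreal ((C * u) powr p) * ennreal ?m"
      by (rule mult_right_mono) simp
    then have "?I \<le> ennreal ((C * u) powr p * ?m)"
      using m by (simp add: ennreal_divide_times ennreal_mult)
    moreover have "(\<integral>\<^sup>+ x. ennreal (\<bar>?f x\<bar> powr p) \<partial>lebesgue) = ?I"
      using weight_nonneg[OF w] by (intro nn_integral_cong_AE) (auto elim!: eventually_mono simp: indicator_def)
    ultimately have "Lorentz_norm p q ?f \<le> ennreal (D * ((C * u) powr p * ?m) powr (1 / p))"
      unfolding D_def by (intro Lorentz_norm_le weight_restrict_measurable[OF w Q] p pos) simp
    also have "((C * u) powr p * ?m) powr (1 / p) = C * u * ?m powr (1 / p)"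
      using C u p by (simp add: powr_mult powr_powr)
    finally have "Lorentz_norm p q ?f / ennreal (?m powr (1 / p)) \<le>
        ennreal (D * (C * u * ?m powr (1 / p))) / ennreal (?m powr (1 / p))"
      by (rule divide_right_mono_ennreal)
    also have "\<dots> = ennreal (D * C * u)"
      using m D C u by (simp add: divide_ennreal)
    finally show ?thesis
      by (simp add: u_def)
  qed
  moreover have "0 < D * C"
    using D C by simp
  ultimately show "w \<in> RH_Lorentz p q"
    unfolding RH_Lorentz_def using w by blast
qed

theorem theorem7:
  fixes p q :: real
  assumes "1 < p" and "p \<le> q"
  shows "(RH_Lorentz p q :: (real ^ 'n \<Rightarrow> real) set) = RH p"
  using RH_Lorentz_subset_RH[OF assms] RH_subset_RH_Lorentz[OF assms] by blast

end
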